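(* For $s,t\in\mathbb{R}$ let $v_s(t)=(1-ist-e^{-ist})/t^2$ for $t\neq 0$ and $v_s(0)=s^2/2$. For $f\in\mathcal{A}_c(\mathbb{R})$ with primitive $F$ define $\Omega_f(s)=\int_{-\infty}^{\infty} v_s f$. Then: (a) $|\Omega_f(s)|\le c\|f\|s^2$ for all $s\in\mathbb{R}$, where $c=\int_{-\infty}^\infty|v_1'(t)|\,dt=\mathrm{var}(v_1)$. Consequently $\Omega_f$ is differentiable at $0$ with $\Omega_f'(0)=0$. The constant $c$ is the best possible (i.e. no smaller constant makes the inequality hold for all $f\in\mathcal{A}_c(\mathbb{R})$ and $s$). (b) $\Omega_f(s)\sim F(\infty)s^2/2$ as $s\to 0$. Also $\Omega_f(s)=o(s^2)$ as $|s|\to\infty$, and this growth estimate is sharp: for every $\psi:[0,\infty)\to(0,\infty)$ with $\psi(s)=o(s^2)$ as $s\to\infty$ there exists $f\in\mathcal{A}_c(\mathbb{R})$ (which may even be chosen Henstock--Kurzweil integrable) such that $\Omega_f(s)/\psi(s)\not\to 0$ as $s\to\infty$. (c) There is a constant $k$ (independent of $f$, $s$, $h$) such that for each $s\in\mathbb{R}$ and $0<|h|<1/e$, $$|\Omega_f(s+h)-\Omega_f(s)|\le k\|f\|\big(|s|\,|h|\,|\log|h||+(s^2+1)|h|\big).$$ Consequently $\Omega_f$ is continuous on $\mathbb{R}$ and Hölder continuous on each compact interval of $\mathbb{R}$ with every exponent $0<\alpha<1$. (d) $\Omega_f$ need not be Lipschitz continuous: there exists $f\in\mathcal{A}_c(\mathbb{R})$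 for which $\Omega_f$ is not Lipschitz continuous. (e) Let $1<\rho<\infty$ and $1/\rho+1/\sigma=1$, and let $u_s(t)=(1-e^{-ist})/(it)$. Then for all $s,h\in\mathbb{R}$, $$|\Omega_f(s+h)-\Omega_f(s)|\le\|f\|\Big[\mathrm{var}(v_1)h^2+\|u_1'\|_\rho\|u_1\|_\sigma|h|^{2-1/\rho}|s|^{1/\rho}+\|u_1\|_\rho\|u_1'\|_\sigma|h|^{1-1/\rho}|s|^{1+1/\rho}\Big].$$
   Context: A function $F:[-\infty,\infty]\to\mathbb{C}$ is continuous on the extended real line if it is continuous on $\mathbb{R}$ and the limits $F(\pm\infty)=\lim_{x\to\pm\infty}F(x)$ exist. $\mathcal{B}_c(\mathbb{R})$ is the set of such $F$ with $F(-\infty)=0$. $\mathcal{A}_c(\mathbb{R})$ is the set of tempered distributions $f$ with $f=F'$ (distributional derivative) for some (unique) $F\in\mathcal{B}_c(\mathbb{R})$, called the primitive of $f$; the continuous primitive integral is $\int_a^b f=F(b)-F(a)$ and the Alexiewicz norm is $\|f\|=\sup_{x\in\mathbb{R}}|F(x)|$. For $g$ of bounded variation on $\mathbb{R}$, $\int_{-\infty}^\infty fg=F(\infty)g(\infty)-\int_{-\infty}^\infty F\,dg$ (Stieltjes integral). $\mathcal{A}_c(\mathbb{R})$ contains $L^1(\mathbb{R})$ and the Henstock--Kurzweil integrable functions. $\mathrm{var}$ denotes total variation on $\mathbb{R}$; $v_1'$, $u_1'$ denote derivatives in $t$; $\|\cdot\|_\rho$ is the $L^\rho(\mathbb{R})$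 norm. *)

theory Defs
  imports "HOL-Analysis.Analysis"
begin

text \<open>Elements f of A_c(R) are represented by their (unique) primitives F in B_c(R).\<close>

definition Bc :: "(real \<Rightarrow> complex) set" where
  "Bc = {F. continuous_on UNIV F \<and> (F \<longlongrightarrow> 0) at_bot \<and> (\<exists>L. (F \<longlongrightarrow> L) at_top)}"

definition Finf :: "(real \<Rightarrow> complex) \<Rightarrow> complex" where
  "Finf F = Lim at_top F"

definition alex :: "(real \<Rightarrow> complex) \<Rightarrow> real" where
  "alex F = (SUP x. norm (F x))"

definition vfun :: "real \<Rightarrow> real \<Rightarrow> complex" where
  "vfun s t = (if t = 0 then complex_of_real (s^2 / 2)
     else (1 - \<i> * s * t - exp (- \<i> * s * t)) / complex_of_real (t^2))"

definition ufun :: "real \<Rightarrow> real \<Rightarrow> complex" where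
  "ufun s t = (if t = 0 then complex_of_real s
     else (1 - exp (- \<i> * s * t)) / (\<i> * t))"

text \<open>Integral of f g for f in A_c with primitive F and g of bounded variation
  (here g continuously differentiable with integrable derivative, so the Stieltjes
  integral of F dg is the Lebesgue integral of F g'):
  F(inf) g(inf) - integral of F dg.\<close>
definition Ac_int :: "(real \<Rightarrow> complex) \<Rightarrow> (real \<Rightarrow> complex) \<Rightarrow> complex" where
  "Ac_int F g = Finf F * Lim at_top g
     - (LINT t|lborel. F t * vector_derivative g (at t))"

definition Omega :: "(real \<Rightarrow> complex) \<Rightarrow> real \<Rightarrow> complex" where
  "Omega F s = Ac_int F (vfun s)"

definition tvar :: "(real \<Rightarrow> complex) \<Rightarrow> real" where
  "tvar g = (SUP xs \<in> {xs :: real list. sorted xs}.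
      (\<Sum>i < length xs - 1. norm (g (xs ! Suc i) - g (xs ! i))))"

definition Lpnorm :: "real \<Rightarrow> (real \<Rightarrow> complex) \<Rightarrow> real" where
  "Lpnorm p g = (LINT t|lborel. norm (g t) powr p) powr (1 / p)"

end

theory Submission
  imports Defs
begin

text \<open>
  Since \<open>v\<^sub>s(t) = s\<^sup>2 v\<^sub>1(s t)\<close> vanishes at infinity, \<open>\<Omega>\<^sub>f(s) = - \<integral> F(t) s\<^sup>3 v\<^sub>1'(s t) dt\<close>, and rescaling by
  \<open>s\<close> reduces the bound in (a) and the limits in (b) to \<open>v\<^sub>1' \<in> L\<^sup>1\<close> and dominated convergence. The
  constant is approached by \<open>F = - cnj v\<^sub>1' / (|v\<^sub>1'| + 1/n)\<close>.

  For the sharpness of the growth estimate, \<open>Re v\<^sub>s \<ge> 0\<close>, so ramps \<open>r(a t) = min (max (a t) 0) 1\<close>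
  contribute nonnegatively to \<open>Re \<Omega>\<close>; take \<open>F(t) = \<Sum>n. 2\<^sup>-\<^sup>n r(s\<^sub>n t)\<close> with \<open>\<psi>(s\<^sub>n) < 2\<^sup>-\<^sup>n s\<^sub>n\<^sup>2\<close>.
  Choosing \<open>\<psi>(s) = s\<^sup>3\<^sup>/\<^sup>2\<close> gives an \<open>\<Omega>\<^sub>f\<close> that outgrows every linear function, hence (d).

  The increments rest on the identity \<open>v\<^sub>s\<^sub>+\<^sub>h - v\<^sub>s = v\<^sub>h + u\<^sub>h u\<^sub>s\<close>: Hoelder's inequality for the
  derivative of the product gives (e), and splitting the line at \<open>|t| = 1\<close> and \<open>|t| = 1/|h|\<close> gives (c).
\<close>

text \<open>A primitive in \<open>Bc\<close> is only bounded and continuous, so the one general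
  estimate available is \<open>alex F\<close> times the L1 norm of the t-derivative of the kernel,
  and every claim becomes a question about that derivative. The function \<open>v\<^sub>1'\<close>
  is of order 1/t^2 and integrable, but \<open>u\<^sub>1\<close> and \<open>u\<^sub>1'\<close> are
  both only of order 1/|t|: this is why they are estimated in products, and why (e) needs exponents
  strictly between 1 and infinity. In (c) the factor \<open>u\<^sub>h\<close> has size about |h|
  until |t| reaches 1/|h|, so between the two splitting points the product
  \<open>u\<^sub>h u\<^sub>s'\<close> is controlled only by |s| |h| / |t|; integrating this produces
  the logarithm. The term 1/n in the near-extremal F replaces the phase of
  \<open>v\<^sub>1'\<close>, which is undefined at its zeros, by a continuous function that tends to
  0 at both ends. In the growth construction the choice s = \<open>s\<^sub>m\<close> rescales the
  m-th ramp to slope 1, so its contribution is \<open>2\<^sup>-\<^sup>m s\<^sub>m\<^sup>2\<close>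
  times a fixed positive number.\<close>

section \<open>The kernels as Fourier integrals over the unit interval\<close>

text \<open>In this form the kernels are smooth and bounded across the removable singularity at 0.\<close>

definition fkern :: "(real \<Rightarrow> complex) \<Rightarrow> real \<Rightarrow> complex" where
  "fkern p t = integral {0..1} (\<lambda>r. p r * cis (- (r * t)))"

lemma cis_has_vector_derivative:
  "((\<lambda>x. cis (- (a * x))) has_vector_derivative (- \<i> * of_real a * cis (- (a * x)))) (at x within S)"
proof -
  have "((\<lambda>z. exp (- \<i> * of_real a * z)) has_field_derivative (- \<i> * of_real a * exp (- \<i> * of_real a * of_real x)))
      (at (of_real x))"
    by (auto intro!: derivative_eq_intros)
  from has_vector_derivative_real_field[OF this]
  show ?thesis by (simp add: cis_conv_exp mult.assoc)
qed

lemma fkern_integrable: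
  assumes "continuous_on {0..1} p"
  shows "(\<lambda>r. p r * cis (- (r * t))) integrable_on {0..1}"
  by (intro integrable_continuous_interval continuous_intros assms)

text \<open>Each derivative of a kernel is again of the form \<open>fkern p\<close>, so continuity
  and the uniform bound \<open>norm_fkern_le\<close> apply to \<open>du\<close> and
  \<open>dv\<close> as well.\<close>

lemma fkern_has_vector_derivative:
  assumes p: "continuous_on {0..1} p"
  shows "(fkern p has_vector_derivative fkern (\<lambda>r. - \<i> * of_real r * p r) t) (at t)"
proof -
  have "((\<lambda>t. integral (cbox 0 1) (\<lambda>r. p r * cis (- (r * t)))) has_vector_derivative
      integral (cbox 0 1) (\<lambda>r. (- \<i> * of_real r * p r) * cis (- (r * t)))) (at t within UNIV)"
  proof (rule leibniz_rule_vector_derivative)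
    show "((\<lambda>t. p r * cis (- (r * t))) has_vector_derivative
        (- \<i> * of_real r * p r) * cis (- (r * t))) (at t within UNIV)" for r t
      by (rule has_vector_derivative_eq_rhs,
          rule has_vector_derivative_mult_right[OF cis_has_vector_derivative]) simp
    show "(\<lambda>r. p r * cis (- (r * t))) integrable_on cbox 0 1" for t
      using fkern_integrable[OF p] by simp
    have "continuous_on (UNIV \<times> {0..1}) (\<lambda>z::real \<times> real. p (snd z))"
      by (rule continuous_on_compose2[OF p]) (auto intro!: continuous_intros)
    then show "continuous_on (UNIV \<times> cbox 0 1) (\<lambda>(t, r). (- \<i> * of_real r * p r) * cis (- (r * t)))"
      by (auto simp: split_beta intro!: continuous_intros)
  qed auto
  then show ?thesis by (simp add: fkern_def[abs_def])
qed

lemma continuous_fkern: "continuous_on {0..1} p \<Longrightarrow> continuous_on UNIV (fkern p)"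
  by (meson continuous_at_imp_continuous_on fkern_has_vector_derivative has_vector_derivative_continuous)

lemma norm_fkern_le:
  assumes p: "continuous_on {0..1} p" and le: "\<And>r. r \<in> {0..1} \<Longrightarrow> norm (p r) \<le> 1"
  shows "norm (fkern p t) \<le> 1"
proof -
  have "norm (fkern p t) \<le> integral {0..1} (\<lambda>r::real. 1::real)"
    unfolding fkern_def
    by (rule integral_norm_bound_integral) (auto simp: norm_mult le intro!: fkern_integrable p)
  then show ?thesis by simp
qed

lemma ufun_eq_fkern: "ufun 1 = fkern (\<lambda>r. 1)"
proof
  fix t :: real
  show "ufun 1 t = fkern (\<lambda>r. 1) t"
  proof (cases "t = 0")
    case False
    have "((\<lambda>r. cis (- (t * r))) has_vector_derivative (- \<i> * of_real t * cis (- (t * r)))) (at r within {0..1})" for r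
      by (rule cis_has_vector_derivative)
    from has_vector_derivative_mult_right[OF this, of "\<i> / of_real t"]
    have "((\<lambda>r. \<i> / of_real t * cis (- (t * r))) has_vector_derivative cis (- (r * t))) (at r within {0..1})" for r
      using False by (simp add: mult.commute)
    then have "((\<lambda>r. cis (- (r * t))) has_integral
        (\<i> / of_real t * cis (- (t * 1)) - \<i> / of_real t * cis (- (t * 0)))) {0..1}"
      by (intro fundamental_theorem_of_calculus) auto
    then have "fkern (\<lambda>r. 1) t = \<i> / of_real t * cis (- t) - \<i> / of_real t"
      unfolding fkern_def by (simp add: integral_unique)
    also have "\<dots> = ufun 1 t"
      using False by (simp add: ufun_def cis_conv_exp field_simps)
    finally show ?thesis by simp
  qed (simp add: ufun_def fkern_def)
qed

text \<open>Taylor's formula of second order for \<open>cis (- t)\<close> with integral remainder,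
  the density being the remainder weight; \<open>ufun_eq_fkern\<close> is the first-order
  case.\<close>

lemma vfun_eq_fkern: "vfun 1 = fkern (\<lambda>r. of_real (1 - r))"
proof
  fix t :: real
  show "vfun 1 t = fkern (\<lambda>r. of_real (1 - r)) t"
  proof (cases "t = 0")
    case False
    \<comment> \<open>An antiderivative of the integrand in \<open>r\<close>, found by one
      integration by parts.\<close>
    define P where "P r = (\<i> * of_real (1 - r) / of_real t - 1 / of_real (t^2)) * cis (- (t * r))" for r
    have "(P has_vector_derivative of_real (1 - r) * cis (- (r * t))) (at r within {0..1})" for r
    proof -
      have "((\<lambda>z. \<i> * (1 - z) / of_real t - 1 / of_real (t^2)) has_field_derivative - (\<i> / of_real t))
          (at (of_real r))"
        using False by (auto intro!: derivative_eq_intros)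
      from has_vector_derivative_real_field[OF this]
      have 1: "((\<lambda>r. \<i> * of_real (1 - r) / of_real t - 1 / of_real (t^2)) has_vector_derivative - (\<i> / of_real t))
          (at r within {0..1})" by simp
      show ?thesis
        unfolding P_def
        by (rule has_vector_derivative_eq_rhs, rule has_vector_derivative_mult[OF 1 cis_has_vector_derivative])
           (use False in \<open>simp add: field_simps power2_eq_square\<close>)
    qed
    then have "((\<lambda>r. of_real (1 - r) * cis (- (r * t))) has_integral (P 1 - P 0)) {0..1}"
      by (intro fundamental_theorem_of_calculus) auto
    then have "fkern (\<lambda>r. of_real (1 - r)) t = P 1 - P 0"
      unfolding fkern_def by (simp add: integral_unique)
    then show ?thesis
      using False by (simp add: vfun_def P_def cis_conv_exp field_simps power2_eq_square)
  next
    case True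
    have "((\<lambda>r::real. 1 - r) has_integral (1 - 1^2/2) - (0 - 0^2/2)) {0..1}"
      by (rule fundamental_theorem_of_calculus)
         (auto intro!: derivative_eq_intros simp flip: has_real_derivative_iff_has_vector_derivative)
    then have "((\<lambda>r::real. complex_of_real (1 - r)) has_integral of_real (1/2)) {0..1}"
      using has_integral_linear[where h = complex_of_real, OF _ bounded_linear_of_real, of "\<lambda>r. 1 - r" "1/2" "{0..1}"] by (simp add: o_def)
    then show ?thesis
      using True by (simp add: vfun_def fkern_def integral_unique)
  qed
qed

abbreviation (input) du :: "real \<Rightarrow> complex" where
  "du t \<equiv> vector_derivative (ufun 1) (at t)"

abbreviation (input) dv :: "real \<Rightarrow> complex" where
  "dv t \<equiv> vector_derivative (vfun 1) (at t)"

lemma du_eq_fkern: "du t = fkern (\<lambda>r. - \<i> * of_real r) t"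
  unfolding ufun_eq_fkern
  using fkern_has_vector_derivative[of "\<lambda>r. 1" t] by (auto intro: vector_derivative_at)

lemma dv_eq_fkern: "dv t = fkern (\<lambda>r. - \<i> * of_real r * of_real (1 - r)) t"
  unfolding vfun_eq_fkern
  by (rule vector_derivative_at[OF fkern_has_vector_derivative]) (intro continuous_intros)

lemma ufun_1_has_vector_derivative: "(ufun 1 has_vector_derivative du t) (at t)"
  \<comment> \<open>The term \<open>du t\<close> contains \<open>ufun 1\<close>, so it has to be
    rewritten before \<open>ufun 1\<close> itself is.\<close>
  unfolding du_eq_fkern unfolding ufun_eq_fkern
  using fkern_has_vector_derivative[of "\<lambda>r. 1" t] by simp

lemma vfun_1_has_vector_derivative: "(vfun 1 has_vector_derivative dv t) (at t)"
  unfolding dv_eq_fkern unfolding vfun_eq_fkern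
  by (rule fkern_has_vector_derivative) (intro continuous_intros)

lemma continuous_ufun: "continuous_on UNIV (ufun 1)"
  and continuous_du: "continuous_on UNIV du"
  and continuous_vfun: "continuous_on UNIV (vfun 1)"
  and continuous_dv: "continuous_on UNIV dv"
  unfolding du_eq_fkern dv_eq_fkern unfolding ufun_eq_fkern vfun_eq_fkern
  by (intro continuous_fkern continuous_intros)+

section \<open>Decay of the kernels\<close>

lemma norm_ufun_le_1: "norm (ufun 1 t) \<le> 1"
  unfolding ufun_eq_fkern by (rule norm_fkern_le) auto

lemma norm_du_le_1: "norm (du t) \<le> 1"
  unfolding du_eq_fkern by (rule norm_fkern_le) (auto simp: norm_mult intro!: continuous_intros)

lemma norm_dv_le_1: "norm (dv t) \<le> 1"
  unfolding dv_eq_fkern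
  by (rule norm_fkern_le) (auto simp: norm_mult mult_le_one simp del: of_real_diff intro!: continuous_intros)

text \<open>Clearing the denominator gives identities that also hold at \<open>t = 0\<close>, so
  they can be differentiated at every point.\<close>

lemma ufun_times: "\<i> * of_real t * ufun 1 t = 1 - cis (- t)"
  by (simp add: ufun_def cis_conv_exp)

lemma vfun_times: "of_real t * vfun 1 t = \<i> * (ufun 1 t - 1)"
  by (simp add: ufun_def vfun_def field_simps power2_eq_square)

text \<open>
  Differentiating the two identities above expresses the derivatives through \<open>u\<^sub>1\<close> and \<open>v\<^sub>1\<close>; each
  division by \<open>t\<close> gains one order of decay.
\<close>

lemma du_times: "of_real t * du t = cis (- t) - ufun 1 t"
proof -
  have "((\<lambda>t. \<i> * (of_real t * ufun 1 t)) has_vector_derivative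
      \<i> * (of_real t * du t + 1 * ufun 1 t)) (at t)"
    by (intro has_vector_derivative_mult_right has_vector_derivative_mult has_vector_derivative_of_real
          ufun_1_has_vector_derivative) (auto intro!: derivative_eq_intros)
  moreover have "((\<lambda>t. \<i> * (of_real t * ufun 1 t)) has_vector_derivative \<i> * cis (- t)) (at t)"
    using has_vector_derivative_diff[OF has_vector_derivative_const cis_has_vector_derivative, of 1 1 t UNIV]
    by (simp add: ufun_times mult.assoc[symmetric])
  ultimately have "\<i> * (of_real t * du t + 1 * ufun 1 t) = \<i> * cis (- t)"
    by (rule vector_derivative_unique_at)
  then show ?thesis by (simp add: eq_diff_eq)
qed

lemma dv_times: "of_real t * dv t = \<i> * du t - vfun 1 t"
proof -
  have "((\<lambda>t. of_real t * vfun 1 t) has_vector_derivative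
      of_real t * dv t + 1 * vfun 1 t) (at t)"
    by (intro has_vector_derivative_mult has_vector_derivative_of_real
          vfun_1_has_vector_derivative) (auto intro!: derivative_eq_intros)
  moreover have "((\<lambda>t. of_real t * vfun 1 t) has_vector_derivative \<i> * du t) (at t)"
    unfolding vfun_times
    using has_vector_derivative_mult_right[OF has_vector_derivative_diff[OF ufun_1_has_vector_derivative has_vector_derivative_const], of \<i>]
    by simp
  ultimately have "of_real t * dv t + 1 * vfun 1 t = \<i> * du t"
    by (rule vector_derivative_unique_at)
  then show ?thesis by (simp add: algebra_simps)
qed

lemma norm_ufun_decay: "\<bar>t\<bar> * norm (ufun 1 t) \<le> 2"
proof -
  have "\<bar>t\<bar> * norm (ufun 1 t) = norm (1 - cis (- t))"
    unfolding ufun_times[symmetric] by (simp add: norm_mult)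
  also have "\<dots> \<le> 2" using norm_triangle_ineq4[of 1 "cis (- t)"] by simp
  finally show ?thesis .
qed

lemma norm_du_decay: "\<bar>t\<bar> * norm (du t) \<le> 2"
proof -
  have "\<bar>t\<bar> * norm (du t) = norm (cis (- t) - ufun 1 t)"
    unfolding du_times[symmetric] by (simp add: norm_mult)
  also have "\<dots> \<le> 2"
    using norm_triangle_ineq4[of "cis (- t)" "ufun 1 t"] norm_ufun_le_1[of t] by simp
  finally show ?thesis .
qed

lemma norm_vfun_decay: "\<bar>t\<bar> * norm (vfun 1 t) \<le> 2"
proof -
  have "\<bar>t\<bar> * norm (vfun 1 t) = norm (ufun 1 t - 1)"
    using arg_cong[OF vfun_times[of t], of norm] by (simp add: norm_mult)
  also have "\<dots> \<le> 2"
    using norm_triangle_ineq4[of "ufun 1 t" 1] norm_ufun_le_1[of t] by simp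
  finally show ?thesis .
qed

text \<open>Both terms on the right of \<open>dv_times\<close> are at most 2 / |t|; dividing by
  \<open>t\<close> once more yields the quadratic decay that makes \<open>dv\<close>
  integrable.\<close>

lemma norm_dv_decay: "t\<^sup>2 * norm (dv t) \<le> 4"
proof -
  have "\<bar>t\<bar> * norm (dv t) = norm (\<i> * du t - vfun 1 t)"
    unfolding dv_times[symmetric] by (simp add: norm_mult)
  also have "\<dots> \<le> norm (du t) + norm (vfun 1 t)"
    using norm_triangle_ineq4[of "\<i> * du t" "vfun 1 t"] by (simp add: norm_mult)
  finally have "\<bar>t\<bar> * (\<bar>t\<bar> * norm (dv t)) \<le> \<bar>t\<bar> * (norm (du t) + norm (vfun 1 t))"
    by (intro mult_left_mono) auto
  also have "\<dots> \<le> 4" using norm_du_decay[of t] norm_vfun_decay[of t] by (simp add: algebra_simps)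
  finally show ?thesis by (simp add: power2_eq_square mult.assoc[symmetric])
qed

text \<open>A single majorant that joins the uniform bound near 0 to the decay at infinity, so that
  estimates need no case distinction in \<open>t\<close>; its powers with exponent above 1 are
  integrable.\<close>

definition decay :: "real \<Rightarrow> real" where
  "decay t = 1 / (1 + \<bar>t\<bar>)"

lemma decay_pos: "0 < decay t" and decay_le_1: "decay t \<le> 1"
  and abs_times_decay_le_1: "\<bar>t\<bar> * decay t \<le> 1"
  by (auto simp: decay_def field_simps)

text \<open>Adding the two hypotheses gives (1 + |t|) a \<le> 3, and 4 leaves some room.\<close>

lemma le_decayI:
  assumes "a \<le> 1" "\<bar>t\<bar> * a \<le> 2"
  shows "a \<le> 4 * decay t"
  using assms by (auto simp: decay_def field_simps)

lemma norm_ufun_le_decay: "norm (ufun 1 t) \<le> 4 * decay t"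
  by (intro le_decayI norm_ufun_le_1 norm_ufun_decay)

lemma norm_du_le_decay: "norm (du t) \<le> 4 * decay t"
  by (intro le_decayI norm_du_le_1 norm_du_decay)

lemma norm_vfun_le_decay: "norm (vfun 1 t) \<le> 4 * decay t"
proof (intro le_decayI norm_vfun_decay)
  show "norm (vfun 1 t) \<le> 1"
    unfolding vfun_eq_fkern
    by (rule norm_fkern_le) (auto simp del: of_real_diff intro!: continuous_intros)
qed

text \<open>The constant is 10 = 2 * (1 + 4): the factor 2 comes from comparing (1 + |t|)^2 with 1 +
  t^2, and 1 and 4 are the bounds for \<open>norm (dv t)\<close> and
  \<open>t\<^sup>2 * norm (dv t)\<close>.\<close>

lemma norm_dv_le_decay: "norm (dv t) \<le> 10 * (decay t)\<^sup>2"
proof -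
  have "(1 + \<bar>t\<bar>)\<^sup>2 \<le> 2 * (1 + t\<^sup>2)"
    using sum_squares_bound[of 1 "\<bar>t\<bar>"] by (simp add: power2_sum)
  then have "(1 + \<bar>t\<bar>)\<^sup>2 * norm (dv t) \<le> 2 * (1 + t\<^sup>2) * norm (dv t)"
    by (rule mult_right_mono) simp
  also have "\<dots> \<le> 10" using norm_dv_decay[of t] norm_dv_le_1[of t] by (simp add: algebra_simps)
  finally show ?thesis
    by (simp add: decay_def power_divide pos_le_divide_eq mult.commute)
qed

lemma decay_powr_integrable:
  assumes "1 < p"
  shows "integrable lborel (\<lambda>t. decay t powr p)"
proof -
  let ?f = "\<lambda>t::real. (1 + \<bar>t\<bar>) powr (- p)"
  let ?F = "\<lambda>t. (1 + t) powr (1 - p) / (1 - p)"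
  have lim: "(?F \<longlongrightarrow> 0 / (1 - p)) at_top"
    using assms by (intro tendsto_divide tendsto_const tendsto_neg_powr filterlim_tendsto_add_at_top[OF tendsto_const filterlim_ident]) auto
  have "(\<integral>\<^sup>+t. ennreal (?f t) * indicator {0..} t \<partial>lborel) = ennreal (0 / (1 - p) - ?F 0)"
  proof (rule nn_integral_FTC_atLeast[OF _ _ _ lim])
    show "DERIV ?F t :> ?f t" if "0 \<le> t" for t
      using that assms by (auto intro!: derivative_eq_intros)
  qed auto
  then have 1: "integrable lborel (\<lambda>t. ?f t * indicator {0..} t)"
    by (intro integrableI_nonneg)
       (auto simp: ennreal_mult' ennreal_indicator[symmetric] less_top[symmetric] simp del: ennreal_indicator)
  \<comment> \<open>Reflection handles the negative half line. The sum of the two pieces counts the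
    point 0 twice, so it serves as a majorant of \<open>?f\<close>.\<close>
  then have "integrable lborel (\<lambda>t. ?f (0 + (-1) * t) * indicator {0..} (0 + (-1) * t))"
    by (rule lborel_integrable_real_affine) simp
  note int = Bochner_Integration.integrable_add[OF 1 this]
  have "integrable lborel ?f"
    by (rule Bochner_Integration.integrable_bound[OF int]) (auto simp: indicator_def)
  moreover have "?f t = decay t powr p" for t
    unfolding decay_def powr_minus_divide by (subst powr_divide) auto
  ultimately show ?thesis by simp
qed

lemma decay_square_integrable: "integrable lborel (\<lambda>t. (decay t)\<^sup>2)"
  using decay_powr_integrable[of 2] decay_pos[THEN less_imp_le]
  by (simp add: powr_numeral)

lemma borel_measurable_ufun [measurable]: "ufun 1 \<in> borel_measurable borel"
  and borel_measurable_du [measurable]: "du \<in> borel_measurable borel"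
  and borel_measurable_dv [measurable]: "dv \<in> borel_measurable borel"
  by (intro borel_measurable_continuous_onI continuous_ufun continuous_du continuous_dv)+

lemma dv_integrable: "integrable lborel dv"
  by (rule Bochner_Integration.integrable_bound[OF integrable_mult_right[OF decay_square_integrable, of 10]])
     (use norm_dv_le_decay in auto)

lemma decay_tendsto_0: "(decay \<longlongrightarrow> 0) at_top" "(decay \<longlongrightarrow> 0) at_bot"
proof -
  have "(decay \<longlongrightarrow> 0) at_infinity"
    unfolding decay_def[abs_def]
    by (rule tendsto_divide_0[OF tendsto_const], rule filterlim_at_top_imp_at_infinity,
        rule filterlim_tendsto_add_at_top[OF tendsto_const])
       (use filterlim_norm_at_top[where 'a = real] in \<open>simp add: real_norm_def[abs_def]\<close>)
  then show "(decay \<longlongrightarrow> 0) at_top" "(decay \<longlongrightarrow> 0) at_bot"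
    by (auto intro: tendsto_mono[OF at_top_le_at_infinity] tendsto_mono[OF at_bot_le_at_infinity])
qed

lemma vfun_tendsto_0: "(vfun 1 \<longlongrightarrow> 0) at_top" "(vfun 1 \<longlongrightarrow> 0) at_bot"
  by (rule Lim_null_comparison[OF always_eventually[rule_format, OF norm_vfun_le_decay]],
      rule tendsto_mult_right_zero, rule decay_tendsto_0)+

lemma dv_tendsto_0: "(dv \<longlongrightarrow> 0) at_top" "(dv \<longlongrightarrow> 0) at_bot"
  by (rule Lim_null_comparison[OF always_eventually[rule_format, OF norm_dv_le_decay]],
      rule tendsto_mult_right_zero, rule tendsto_null_power, rule decay_tendsto_0, simp)+

section \<open>Scaling and addition formulas for the kernels, and integrals of
  \<open>dv\<close>\<close>

lemma vfun_scale: "vfun s t = of_real (s\<^sup>2) * vfun 1 (s * t)"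
  by (auto simp: vfun_def power_mult_distrib mult.assoc)

lemma ufun_scale: "ufun s t = of_real s * ufun 1 (s * t)"
  by (auto simp: ufun_def mult.assoc)

lemma has_vector_derivative_scale:
  fixes f :: "real \<Rightarrow> complex"
  assumes "(f has_vector_derivative f') (at (s * t))"
  shows "((\<lambda>t. a * f (s * t)) has_vector_derivative a * of_real s * f') (at t)"
proof -
  have "((\<lambda>t. s * t) has_vector_derivative s) (at t)"
    by (auto intro!: derivative_eq_intros simp flip: has_real_derivative_iff_has_vector_derivative)
  from vector_diff_chain_at[OF this, of f f'] assms
  have "((\<lambda>t. f (s * t)) has_vector_derivative s *\<^sub>R f') (at t)" by (simp add: o_def)
  from has_vector_derivative_mult_right[OF this, of a]
  show ?thesis by (simp add: scaleR_conv_of_real mult.assoc)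
qed

lemma vfun_has_vector_derivative:
  "(vfun s has_vector_derivative of_real (s^3) * dv (s * t)) (at t)"
  using has_vector_derivative_scale[OF vfun_1_has_vector_derivative, of "of_real (s\<^sup>2)" s t]
  unfolding vfun_scale[of s, symmetric] by (simp add: power3_eq_cube power2_eq_square)

lemma ufun_has_vector_derivative:
  "(ufun s has_vector_derivative of_real (s\<^sup>2) * du (s * t)) (at t)"
  using has_vector_derivative_scale[OF ufun_1_has_vector_derivative, of "of_real s" s t]
  unfolding ufun_scale[of s, symmetric] by (simp add: power2_eq_square)

text \<open>With exponentials \<open>a\<close> and \<open>b\<close> for \<open>s\<close> and
  \<open>h\<close>, the product of the two u-kernels is - (1 - a) (1 - b) / t^2, and expanding it
  supplies exactly the cross term \<open>a * b\<close>. At \<open>t = 0\<close> the identity is the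
  binomial formula for (s + h)^2 / 2.\<close>

lemma vfun_add: "vfun (s + h) t = vfun s t + vfun h t + ufun h t * ufun s t"
proof (cases "t = 0")
  case False
  define a b where "a = exp (- \<i> * of_real s * of_real t)" and "b = exp (- \<i> * of_real h * of_real t)"
  have "exp (- \<i> * of_real (s + h) * of_real t) = a * b"
    by (simp add: a_def b_def exp_add[symmetric] algebra_simps)
  with False show ?thesis
    unfolding vfun_def ufun_def a_def[symmetric] b_def[symmetric]
    by (simp add: field_simps power2_eq_square)
qed (simp add: vfun_def ufun_def field_simps power2_eq_square)

lemma dv_add:
  "of_real ((s + h)^3) * dv ((s + h) * t) = of_real (s^3) * dv (s * t) + of_real (h^3) * dv (h * t)
     + (ufun h t * (of_real (s\<^sup>2) * du (s * t)) + of_real (h\<^sup>2) * du (h * t) * ufun s t)"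
proof -
  have "(vfun (s + h) has_vector_derivative of_real (s^3) * dv (s * t) + of_real (h^3) * dv (h * t)
     + (ufun h t * (of_real (s\<^sup>2) * du (s * t)) + of_real (h\<^sup>2) * du (h * t) * ufun s t)) (at t)"
    unfolding vfun_add[of s h, abs_def]
    by (intro has_vector_derivative_add has_vector_derivative_mult vfun_has_vector_derivative ufun_has_vector_derivative)
  from vector_derivative_unique_at[OF this vfun_has_vector_derivative] show ?thesis by simp
qed

text \<open>The antiderivative \<open>vfun 1\<close> vanishes at both ends. The half-line values at
  \<open>a = 0\<close> are the source of the factor 1/2 in the asymptotics at 0, and the vanishing
  total integral is the source of the o(s^2) growth.\<close>

lemma dv_integral_greaterThan: "(LINT t:{a<..}|lborel. dv t) = - vfun 1 a"
  and dv_integral_lessThan: "(LINT t:{..<a}|lborel. dv t) = vfun 1 a"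
  and dv_integral_UNIV: "(LINT t|lborel. dv t) = 0"
proof -
  have cont: "isCont dv t" for t
    using continuous_dv by (simp add: continuous_on_eq_continuous_at)
  have int: "set_integrable lborel A dv" if "A \<in> sets borel" for A
    using dv_integrable that by (simp add: set_integrable_def integrable_mult_indicator)
  have va: "vfun 1 \<midarrow>a\<rightarrow> vfun 1 a"
    using continuous_vfun by (simp add: continuous_on_eq_continuous_at isCont_def)
  have "(LBINT t=ereal a..\<infinity>. dv t) = 0 - vfun 1 a"
    using va vfun_tendsto_0
    by (intro interval_integral_FTC_integrable[where F = "vfun 1"] vfun_1_has_vector_derivative cont int)
       (auto simp: ereal_tendsto_simps filterlim_at_split)
  moreover have "(LBINT t=-\<infinity>..ereal a. dv t) = vfun 1 a - 0"
    using va vfun_tendsto_0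
    by (intro interval_integral_FTC_integrable[where F = "vfun 1"] vfun_1_has_vector_derivative cont int)
       (auto simp: ereal_tendsto_simps filterlim_at_split)
  moreover have "(LBINT t=-\<infinity>..\<infinity>. dv t) = 0 - 0"
    using vfun_tendsto_0
    by (intro interval_integral_FTC_integrable[where F = "vfun 1"] vfun_1_has_vector_derivative cont int)
       (auto simp: ereal_tendsto_simps filterlim_at_split)
  ultimately show "(LINT t:{a<..}|lborel. dv t) = - vfun 1 a" "(LINT t:{..<a}|lborel. dv t) = vfun 1 a"
      "(LINT t|lborel. dv t) = 0"
    by (simp_all add: interval_lebesgue_integral_def set_lebesgue_integral_def)
qed

section \<open>The transform of a primitive\<close>

text \<open>Without boundedness the supremum in \<open>alex\<close> would be an unspecified real and
  bound nothing. The two limits control the tails, compactness the middle.\<close>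

lemma Bc_bounded:
  assumes "F \<in> Bc"
  shows "bdd_above (range (\<lambda>x. norm (F x)))"
proof -
  obtain L where F: "continuous_on UNIV F" "(F \<longlongrightarrow> 0) at_bot" "(F \<longlongrightarrow> L) at_top"
    using assms by (auto simp: Bc_def)
  have "eventually (\<lambda>x. norm (F x) < norm L + 1) at_top"
    by (rule order_tendstoD(2)[OF tendsto_norm[OF F(3)]]) simp
  then obtain b where b: "\<And>x. x \<ge> b \<Longrightarrow> norm (F x) < norm L + 1"
    by (auto simp: eventually_at_top_linorder)
  have "eventually (\<lambda>x. norm (F x) < 1) at_bot"
    by (rule order_tendstoD(2)[OF tendsto_norm[OF F(2)]]) simp
  then obtain a where a: "\<And>x. x \<le> a \<Longrightarrow> norm (F x) < 1"
    by (auto simp: eventually_at_bot_linorder)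
  have "bounded (F ` {a..b})"
    by (intro compact_imp_bounded compact_continuous_image continuous_on_subset[OF F(1)]) auto
  then obtain C where C: "\<And>x. x \<in> {a..b} \<Longrightarrow> norm (F x) \<le> C"
    unfolding bounded_iff by blast
  have "norm (F x) \<le> max C (norm L + 1)" for x
    using a[of x] b[of x] C[of x] norm_ge_zero[of L] by (smt (verit) atLeastAtMost_iff)
  then show ?thesis by (auto intro!: bdd_aboveI)
qed

lemma norm_le_alex: "F \<in> Bc \<Longrightarrow> norm (F x) \<le> alex F"
  unfolding alex_def by (intro cSUP_upper Bc_bounded) auto

lemma alex_nonneg: "F \<in> Bc \<Longrightarrow> 0 \<le> alex F"
  using norm_le_alex[of F 0] norm_ge_zero order_trans by blast

lemma alex_le: "(\<And>x. norm (F x) \<le> B) \<Longrightarrow> alex F \<le> B"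
  unfolding alex_def by (intro cSUP_least) auto

lemma Bc_tendsto:
  assumes "F \<in> Bc"
  shows "(F \<longlongrightarrow> Finf F) at_top" "(F \<longlongrightarrow> 0) at_bot" "continuous_on UNIV F"
  using assms by (auto simp: Bc_def Finf_def tendsto_Lim)

lemma Bc_measurable [measurable_dest]: "F \<in> Bc \<Longrightarrow> F \<in> borel_measurable borel"
  using Bc_tendsto(3) by (rule borel_measurable_continuous_onI)

lemma integrable_bounded_mult:
  fixes F g :: "real \<Rightarrow> complex"
  assumes F: "F \<in> borel_measurable borel" "\<And>x. norm (F x) \<le> B" and g: "integrable lborel g"
  shows "integrable lborel (\<lambda>x. F x * g x)"
  using integrable_mult_right[OF integrable_norm[OF g], of B]
proof (rule Bochner_Integration.integrable_bound)
  show "(\<lambda>x. F x * g x) \<in> borel_measurable lborel"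
    using F(1) borel_measurable_integrable[OF g] by simp
  show "AE x in lborel. norm (F x * g x) \<le> norm (B * norm (g x))"
  proof (rule AE_I2)
    fix x
    have "norm (F x) * norm (g x) \<le> B * norm (g x)" by (intro mult_right_mono F) auto
    then show "norm (F x * g x) \<le> norm (B * norm (g x))" by (simp add: norm_mult)
  qed
qed

lemma norm_integral_bounded_mult_le:
  fixes F g :: "real \<Rightarrow> complex"
  assumes F: "F \<in> borel_measurable borel" "\<And>x. norm (F x) \<le> B" and g: "integrable lborel g"
  shows "norm (LINT x|lborel. F x * g x) \<le> B * (LINT x|lborel. norm (g x))"
proof -
  have "norm (LINT x|lborel. F x * g x) \<le> (LINT x|lborel. B * norm (g x))"
  proof (rule Bochner_Integration.integral_norm_bound_integral)
    show "norm (F x * g x) \<le> B * norm (g x)" for x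
      unfolding norm_mult by (intro mult_right_mono F) auto
  qed (auto intro!: integrable_bounded_mult assms)
  then show ?thesis using g by simp
qed

lemma dv_scale_integrable: "integrable lborel (\<lambda>t. of_real (s^3) * dv (s * t))"
proof (cases "s = 0")
  case False
  then show ?thesis
    using lborel_integrable_real_affine[OF dv_integrable, of s 0] by simp
qed simp

lemma Omega_eq: "Omega F s = - (LINT t|lborel. F t * (of_real (s^3) * dv (s * t)))"
proof -
  have "(vfun s \<longlongrightarrow> 0) at_top"
  proof (cases "s = 0")
    case True
    then show ?thesis by (simp add: vfun_def[abs_def] cong: if_cong)
  next
    case False
    \<comment> \<open>The sign of \<open>s\<close> is open, so the limit is taken through
      \<open>at_infinity\<close>, which covers both ends.\<close>
    have "filterlim (\<lambda>t. s * t) at_infinity at_top"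
      using False by (simp add: tendsto_mult_filterlim_at_infinity[OF tendsto_const] filterlim_at_top_imp_at_infinity filterlim_ident)
    moreover have "(vfun 1 \<longlongrightarrow> 0) at_infinity"
      using vfun_tendsto_0 by (simp add: at_infinity_eq_at_top_bot filterlim_sup)
    ultimately have "((\<lambda>t. vfun 1 (s * t)) \<longlongrightarrow> 0) at_top"
      by (rule filterlim_compose[rotated])
    then show ?thesis
      unfolding vfun_scale[of s, abs_def] by (rule tendsto_mult_right_zero)
  qed
  then have "Lim at_top (vfun s) = 0" by (intro tendsto_Lim) auto
  moreover have "vector_derivative (vfun s) (at t) = of_real (s^3) * dv (s * t)" for t
    by (rule vector_derivative_at[OF vfun_has_vector_derivative])
  ultimately show ?thesis by (simp add: Omega_def Ac_int_def)
qed

lemma Omega_0: "Omega F 0 = 0"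
  by (simp add: Omega_eq)

text \<open>The substitution has Jacobian 1 / |s|, and s^3 / |s| = s^2 sgn s. The kernel is now
  independent of \<open>s\<close>, which is the form suited to dominated convergence.\<close>

lemma Omega_eq_rescaled:
  assumes "s \<noteq> 0"
  shows "Omega F s = - (of_real (s\<^sup>2 * sgn s) * (LINT t|lborel. F (t / s) * dv t))"
proof -
  have "(LINT t|lborel. F t * dv (s * t)) = \<bar>1 / s\<bar> *\<^sub>R (LINT t|lborel. F (t / s) * dv t)"
    using lborel_integral_real_affine[of "1 / s" "\<lambda>t. F t * dv (s * t)" 0] assms by simp
  moreover have "s^3 * \<bar>1 / s\<bar> = s\<^sup>2 * sgn s"
    using assms by (simp add: sgn_if power2_eq_square power3_eq_cube)
  moreover have "Omega F s = - (of_real (s^3) * (LINT t|lborel. F t * dv (s * t)))"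
    unfolding Omega_eq mult.left_commute[of _ "of_real (s^3)"] integral_mult_right_zero ..
  ultimately show ?thesis
    by (metis (no_types, lifting) mult.assoc of_real_mult scaleR_conv_of_real)
qed

lemma dv_norm_scale_integral: "(LINT t|lborel. norm (of_real (s^3) * dv (s * t))) = s\<^sup>2 * (LINT t|lborel. norm (dv t))"
proof (cases "s = 0")
  case False
  have "(LINT t|lborel. norm (dv t)) = \<bar>s\<bar> * (LINT t|lborel. norm (dv (s * t)))"
    using lborel_integral_real_affine[of s "\<lambda>t. norm (dv t)" 0] False by simp
  then show ?thesis by (simp add: norm_mult norm_power power2_eq_square power3_eq_cube abs_mult[symmetric])
qed simp

section \<open>The quadratic bound and its best constant\<close>

lemma norm_Omega_le:
  assumes "F \<in> Bc"
  shows "norm (Omega F s) \<le> (LINT t|lborel. norm (dv t)) * alex F * s\<^sup>2"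
  using norm_integral_bounded_mult_le[OF Bc_measurable[OF assms] norm_le_alex[OF assms] dv_scale_integrable, of s]
  unfolding Omega_eq dv_norm_scale_integral norm_minus_cancel by (simp only: mult_ac)

lemma Omega_has_vector_derivative_0:
  assumes "F \<in> Bc"
  shows "(Omega F has_vector_derivative 0) (at 0)"
proof -
  define C where "C = (LINT t|lborel. norm (dv t)) * alex F"
  have "((\<lambda>h. norm (Omega F h) / norm h) \<longlongrightarrow> 0) (at 0)"
  proof (rule Lim_null_comparison)
    show "eventually (\<lambda>h. norm (norm (Omega F h) / norm h) \<le> C * \<bar>h\<bar>) (at 0)"
      using norm_Omega_le[OF assms]
      by (intro always_eventually allI) (auto simp: C_def divide_le_eq power2_eq_square mult.assoc)
    show "((\<lambda>h. C * \<bar>h\<bar>) \<longlongrightarrow> 0) (at (0::real))"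
      by (auto intro!: tendsto_eq_intros)
  qed
  then show ?thesis
    by (simp add: has_vector_derivative_def has_derivative_at Omega_0)
qed

text \<open>It supplies the positivity of the constant, so that a negative \<open>c'\<close> can be
  replaced by \<open>max c' 0\<close> in the proof of sharpness. The value 1/2 is
  \<open>norm (vfun 1 0)\<close>.\<close>

lemma dv_norm_integral_ge: "(LINT t|lborel. norm (dv t)) \<ge> 1 / 2"
proof -
  have "1 / 2 = norm (LINT t:{0<..}|lborel. dv t)"
    unfolding dv_integral_greaterThan by (simp add: vfun_def norm_divide)
  also have "\<dots> \<le> (LINT t|lborel. norm (dv t))"
    unfolding set_lebesgue_integral_def
    by (rule Bochner_Integration.integral_norm_bound_integral)
       (auto intro!: dv_integrable integrable_mult_indicator integrable_norm, simp add: indicator_def)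
  finally show ?thesis .
qed

lemma Omega_best_constant:
  assumes "c' < (LINT t|lborel. norm (dv t))"
  shows "\<exists>F\<in>Bc. \<exists>s::real. norm (Omega F s) > c' * alex F * s^2"
proof -
  \<comment> \<open>The minus sign offsets the one in \<open>Omega_eq\<close>, so that
    \<open>- F n t * dv t\<close> is nonnegative and increases to \<open>norm (dv t)\<close>. The
    positive summand in the denominator gives continuity at zeros of \<open>dv\<close> and the
    limits 0 at both ends.\<close>
  define F where "F n t = - cnj (dv t) / of_real (norm (dv t) + inverse (real (Suc n)))" for n t
  have pos: "norm (dv t) + inverse (real (Suc n)) > 0" for n t
    by (intro add_nonneg_pos) auto
  have le1: "norm (F n t) \<le> 1" for n t
    using pos[of t n] by (simp add: F_def norm_divide divide_le_eq del: of_real_add)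
  have F_Bc: "F n \<in> Bc" for n
  proof -
    have "(F n \<longlongrightarrow> - cnj 0 / of_real (norm (0::complex) + inverse (real (Suc n)))) at_top"
         "(F n \<longlongrightarrow> - cnj 0 / of_real (norm (0::complex) + inverse (real (Suc n)))) at_bot"
      unfolding F_def[abs_def] by (intro tendsto_intros dv_tendsto_0; simp del: of_nat_Suc)+
    moreover have "continuous_on UNIV (F n)"
      unfolding F_def[abs_def] using pos
      by (intro continuous_intros continuous_dv) (metis less_irrefl of_real_eq_0_iff)
    ultimately show ?thesis by (auto simp: Bc_def)
  qed
  have F_dv: "F n t * dv t = - of_real ((norm (dv t))\<^sup>2 / (norm (dv t) + inverse (real (Suc n))))" for n t
    using complex_norm_square[of "dv t"] by (simp add: F_def mult.commute)
  have "(\<lambda>n. LINT t|lborel. F n t * dv t) \<longlonglongrightarrow> (LINT t|lborel. - of_real (norm (dv t)))"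
  proof (rule integral_dominated_convergence[where w = "\<lambda>t. norm (dv t)"])
    show "AE t in lborel. norm (F n t * dv t) \<le> norm (dv t)" for n
      using mult_right_mono[OF le1 norm_ge_zero, of n _ "dv _"] by (simp add: norm_mult)
    show "AE t in lborel. (\<lambda>n. F n t * dv t) \<longlonglongrightarrow> - of_real (norm (dv t))"
    proof (rule AE_I2)
      fix t
      show "(\<lambda>n. F n t * dv t) \<longlonglongrightarrow> - of_real (norm (dv t))"
      proof (cases "dv t = 0")
        case False
        have "(\<lambda>n. - complex_of_real ((norm (dv t))\<^sup>2 / (norm (dv t) + inverse (real (Suc n)))))
           \<longlonglongrightarrow> - of_real ((norm (dv t))\<^sup>2 / (norm (dv t) + 0))"
          using False by (intro tendsto_intros LIMSEQ_inverse_real_of_nat) auto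
        then show ?thesis using False by (simp add: F_dv power2_eq_square)
      qed simp
    qed
  qed (use F_Bc in \<open>auto simp: dv_integrable intro!: borel_measurable_times Bc_measurable\<close>)
  then have "(\<lambda>n. norm (LINT t|lborel. F n t * dv t)) \<longlonglongrightarrow> norm (LINT t|lborel. - complex_of_real (norm (dv t)))"
    by (rule tendsto_norm)
  moreover have "norm (LINT t|lborel. - complex_of_real (norm (dv t))) = (LINT t|lborel. norm (dv t))"
    by (simp add: integral_nonneg_AE)
  moreover have "max c' 0 < (LINT t|lborel. norm (dv t))"
    using assms dv_norm_integral_ge by simp
  ultimately have "eventually (\<lambda>n. norm (LINT t|lborel. F n t * dv t) > max c' 0) sequentially"
    by (intro order_tendstoD) auto
  then obtain n where n: "norm (LINT t|lborel. F n t * dv t) > max c' 0"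
    by (auto simp: eventually_sequentially)
  \<comment> \<open>Only the upper bound 1 for \<open>alex (F n)\<close> is at hand, so the factor
    in front of it must be nonnegative.\<close>
  have "c' * alex (F n) \<le> max c' 0 * alex (F n)"
    by (intro mult_right_mono alex_nonneg F_Bc) auto
  also have "\<dots> \<le> max c' 0 * 1"
    by (intro mult_left_mono alex_le le1) auto
  also have "\<dots> < norm (Omega (F n) 1)"
    using n by (simp add: Omega_eq)
  finally show ?thesis using F_Bc by (intro bexI[of _ "F n"] exI[of _ 1]) auto
qed

text \<open>The substitution \<open>g\<close> is arbitrary so that one statement serves both signs
  of \<open>s\<close>, near 0 and near infinity. Convergence is asked almost everywhere because an
  argument such as \<open>t * s\<close> does not move at \<open>t = 0\<close>.\<close>

lemma Omega_integral_tendsto: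
  fixes g :: "real \<Rightarrow> real \<Rightarrow> real"
  assumes F: "F \<in> Bc"
    and lim: "AE t in lborel. ((\<lambda>s. F (g s t)) \<longlongrightarrow> L t) at_top"
    and [measurable]: "L \<in> borel_measurable borel" "\<And>s. g s \<in> borel_measurable borel"
  shows "((\<lambda>s. LINT t|lborel. F (g s t) * dv t) \<longlongrightarrow> (LINT t|lborel. L t * dv t)) at_top"
proof (rule integral_dominated_convergence_at_top[where w = "\<lambda>t. alex F * norm (dv t)"])
  show "\<forall>\<^sub>F s in at_top. AE t in lborel. norm (F (g s t) * dv t) \<le> alex F * norm (dv t)"
    by (intro always_eventually allI AE_I2) (simp add: norm_mult mult_right_mono norm_le_alex F)
  show "AE t in lborel. ((\<lambda>s. F (g s t) * dv t) \<longlongrightarrow> L t * dv t) at_top"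
    using lim by eventually_elim (intro tendsto_intros)
  note [measurable] = Bc_measurable[OF F]
  show "(\<lambda>t. F (g s t) * dv t) \<in> borel_measurable lborel" for s by measurable
qed (auto simp: dv_integrable)

section \<open>Asymptotics and total variation\<close>

lemma Omega_div_square:
  assumes "s \<noteq> 0"
  shows "Omega F s / of_real (s\<^sup>2) = - (of_real (sgn s) * (LINT t|lborel. F (t / s) * dv t))"
  using assms by (simp add: Omega_eq_rescaled)

text \<open>After replacing \<open>s\<close> by its inverse, the rescaled primitive tends to
  \<open>Finf F\<close> times the indicator of a half line: the positive one for s > 0, the negative
  one for s < 0. The integrals of \<open>dv\<close> over them have opposite signs, which
  \<open>sgn s\<close> compensates, so the one-sided limits agree.\<close>

lemma Omega_asymp_0:
  assumes F: "F \<in> Bc"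
  shows "((\<lambda>s. Omega F s / complex_of_real (s^2)) \<longlongrightarrow> Finf F / 2) (at 0)"
proof -
  note lim = Bc_tendsto[OF F]
  have pos: "filterlim (\<lambda>s. t * s) at_top at_top" "filterlim (\<lambda>s. - (t * s)) at_bot at_top" if "t > 0" for t :: real
    using filterlim_tendsto_pos_mult_at_top[OF tendsto_const that filterlim_ident]
    by (auto simp: filterlim_uminus_at_top)
  have neg: "filterlim (\<lambda>s. t * s) at_bot at_top" "filterlim (\<lambda>s. - (t * s)) at_top at_top" if "t < 0" for t :: real
    using pos[of "- t"] that by auto
  have "((\<lambda>s. LINT t|lborel. F (t * s) * dv t) \<longlongrightarrow>
      (LINT t|lborel. (Finf F * indicator {0<..} t) * dv t)) at_top"
  proof (rule Omega_integral_tendsto[OF F])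
    show "AE t in lborel. ((\<lambda>s. F (t * s)) \<longlongrightarrow> Finf F * indicator {0<..} t) at_top"
      using AE_lborel_singleton[of 0]
      by eventually_elim
         (auto simp: indicator_def not_less intro: filterlim_compose[OF lim(1) pos(1)] filterlim_compose[OF lim(2) neg(1)])
  qed auto
  also have "(\<lambda>t. (Finf F * indicator {0<..} t) * dv t) = (\<lambda>t. Finf F * (indicator {0<..} t *\<^sub>R dv t))"
    by (auto simp: indicator_def)
  finally have 1: "((\<lambda>s. LINT t|lborel. F (t * s) * dv t) \<longlongrightarrow> - (Finf F / 2)) at_top"
    using dv_integral_greaterThan[of 0] by (simp add: set_lebesgue_integral_def vfun_def[of 1 0] del: mult_scaleR_right)
  have "((\<lambda>s. LINT t|lborel. F (- (t * s)) * dv t) \<longlongrightarrow>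
      (LINT t|lborel. (Finf F * indicator {..<0} t) * dv t)) at_top"
  proof (rule Omega_integral_tendsto[OF F])
    show "AE t in lborel. ((\<lambda>s. F (- (t * s))) \<longlongrightarrow> Finf F * indicator {..<0} t) at_top"
      using AE_lborel_singleton[of 0]
      by eventually_elim
         (auto simp: indicator_def not_less intro: filterlim_compose[OF lim(2) pos(2)] filterlim_compose[OF lim(1) neg(2)])
  qed auto
  also have "(\<lambda>t. (Finf F * indicator {..<0} t) * dv t) = (\<lambda>t. Finf F * (indicator {..<0} t *\<^sub>R dv t))"
    by (auto simp: indicator_def)
  finally have "((\<lambda>s. LINT t|lborel. F (- (t * s)) * dv t) \<longlongrightarrow>
      (LINT t|lborel. Finf F * (indicator {..<0} t *\<^sub>R dv t))) at_top" .
  moreover have "(LINT t|lborel. indicator {..<0} t *\<^sub>R dv t) = 1 / 2"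
    using dv_integral_lessThan[of 0] by (simp add: set_lebesgue_integral_def vfun_def[of 1 0])
  ultimately have 2: "((\<lambda>s. LINT t|lborel. F (- (t * s)) * dv t) \<longlongrightarrow> Finf F / 2) at_top"
    unfolding integral_mult_right_zero by simp
  have "((\<lambda>s. Omega F (inverse s) / complex_of_real ((inverse s)^2)) \<longlongrightarrow> Finf F / 2) at_top"
  proof (rule Lim_transform_eventually)
    show "((\<lambda>s. - (LINT t|lborel. F (t * s) * dv t)) \<longlongrightarrow> Finf F / 2) at_top"
      using tendsto_minus[OF 1] by simp
    show "\<forall>\<^sub>F s in at_top. - (LINT t|lborel. F (t * s) * dv t) = Omega F (inverse s) / complex_of_real ((inverse s)^2)"
      using eventually_gt_at_top[of 0]
    proof eventually_elim
      case (elim s)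
      then show ?case by (subst Omega_div_square) (auto simp: divide_inverse)
    qed
  qed
  then have R: "((\<lambda>s. Omega F s / complex_of_real (s^2)) \<longlongrightarrow> Finf F / 2) (at_right 0)"
    by (simp add: filterlim_at_right_to_top)
  have "((\<lambda>s. Omega F (- inverse s) / complex_of_real ((- inverse s)^2)) \<longlongrightarrow> Finf F / 2) at_top"
  proof (rule Lim_transform_eventually)
    show "((\<lambda>s. LINT t|lborel. F (- (t * s)) * dv t) \<longlongrightarrow> Finf F / 2) at_top"
      by (rule 2)
    show "\<forall>\<^sub>F s in at_top. (LINT t|lborel. F (- (t * s)) * dv t) = Omega F (- inverse s) / complex_of_real ((- inverse s)^2)"
      using eventually_gt_at_top[of 0]
    proof eventually_elim
      case (elim s)
      then show ?case by (subst Omega_div_square) (auto simp: divide_inverse)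
    qed
  qed
  then have L: "((\<lambda>s. Omega F s / complex_of_real (s^2)) \<longlongrightarrow> Finf F / 2) (at_left 0)"
    by (simp add: filterlim_at_left_to_right[of _ _ 0] filterlim_at_right_to_top)
  show ?thesis using L R by (simp add: filterlim_at_split)
qed

text \<open>For large |s| the argument \<open>t / s\<close> tends to 0, so continuity turns the
  primitive into the constant \<open>F 0\<close>, and \<open>dv\<close> has total integral 0. The
  parameter \<open>a\<close> is 1 or -1, one value for each end.\<close>

lemma Omega_asymp_infinity:
  assumes F: "F \<in> Bc"
  shows "((\<lambda>s. Omega F s / complex_of_real (s^2)) \<longlongrightarrow> 0) at_infinity"
proof -
  have lim: "((\<lambda>s. LINT t|lborel. F (t / (a * s)) * dv t) \<longlongrightarrow> 0) at_top" if "a \<noteq> 0" for a :: real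
  proof -
    have "((\<lambda>s. LINT t|lborel. F (t / (a * s)) * dv t) \<longlongrightarrow> (LINT t|lborel. F 0 * dv t)) at_top"
    proof (rule Omega_integral_tendsto[OF F], rule AE_I2)
      fix t :: real
      have "filterlim (\<lambda>s. a * s) at_infinity at_top"
        using that by (simp add: tendsto_mult_filterlim_at_infinity[OF tendsto_const] filterlim_at_top_imp_at_infinity filterlim_ident)
      then have "((\<lambda>s. t / (a * s)) \<longlongrightarrow> 0) at_top"
        by (rule tendsto_divide_0[OF tendsto_const])
      then show "((\<lambda>s. F (t / (a * s))) \<longlongrightarrow> F 0) at_top"
        using Bc_tendsto(3)[OF F] by (intro isCont_tendsto_compose[of 0 F]) (auto simp: continuous_on_eq_continuous_at)
    qed auto
    then show ?thesis using dv_integral_UNIV by simp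
  qed
  have "((\<lambda>s. Omega F s / complex_of_real (s^2)) \<longlongrightarrow> 0) at_top"
  proof (rule Lim_transform_eventually)
    show "((\<lambda>s. - (LINT t|lborel. F (t / (1 * s)) * dv t)) \<longlongrightarrow> 0) at_top"
      using tendsto_minus[OF lim[of 1]] by simp
    show "\<forall>\<^sub>F s in at_top. - (LINT t|lborel. F (t / (1 * s)) * dv t) = Omega F s / complex_of_real (s^2)"
      using eventually_gt_at_top[of 0]
    proof eventually_elim
      case (elim s)
      then show ?case by (subst Omega_div_square) auto
    qed
  qed
  moreover have "((\<lambda>s. Omega F (- s) / complex_of_real ((- s)^2)) \<longlongrightarrow> 0) at_top"
  proof (rule Lim_transform_eventually)
    show "((\<lambda>s. LINT t|lborel. F (t / (- 1 * s)) * dv t) \<longlongrightarrow> 0) at_top"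
      by (rule lim) simp
    show "\<forall>\<^sub>F s in at_top. (LINT t|lborel. F (t / (- 1 * s)) * dv t) = Omega F (- s) / complex_of_real ((- s)^2)"
      using eventually_gt_at_top[of 0]
    proof eventually_elim
      case (elim s)
      then show ?case by (subst Omega_div_square) auto
    qed
  qed
  ultimately show ?thesis
    by (simp add: at_infinity_eq_at_top_bot filterlim_sup filterlim_at_bot_mirror)
qed

section \<open>Total variation as the integral of the norm of the derivative\<close>

lemma variation_sum_le:
  fixes g g' :: "real \<Rightarrow> complex"
  assumes deriv: "\<And>t. (g has_vector_derivative g' t) (at t)" and int: "integrable lborel g'"
    and cont: "continuous_on UNIV g'" and "sorted xs"
  shows "(\<Sum>i < length xs - 1. norm (g (xs ! Suc i) - g (xs ! i))) \<le> (LINT t|lborel. norm (g' t))"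
proof -
  \<comment> \<open>The cumulative integral dominates \<open>g\<close> increment by increment, and
    its own increments telescope.\<close>
  define G where "G x = (LINT t:{..x}|lborel. norm (g' t))" for x
  have intG: "integrable lborel (\<lambda>t. indicator A t *\<^sub>R norm (g' t))" if "A \<in> sets borel" for A
    using that int by (intro integrable_mult_indicator integrable_norm) auto
  have step: "norm (g y - g x) \<le> G y - G x" if "x \<le> y" for x y
  proof -
    have "(LINT t|lborel. indicator {x..y} t *\<^sub>R g' t) = g y - g x"
      by (rule integral_FTC_Icc[OF that])
         (auto intro: has_vector_derivative_at_within deriv continuous_on_subset[OF cont])
    moreover have "norm (LINT t|lborel. indicator {x..y} t *\<^sub>R g' t) \<le> (LINT t|lborel. indicator {x..y} t *\<^sub>R norm (g' t))"
      by (rule Bochner_Integration.integral_norm_bound_integral)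
         (use int intG in \<open>auto intro!: integrable_mult_indicator\<close>)
    moreover have "(LINT t|lborel. indicator {x..y} t *\<^sub>R norm (g' t)) = G y - G x"
    proof -
      \<comment> \<open>The right side omits the endpoint \<open>x\<close>, hence the equality only
        almost everywhere.\<close>
      have "AE t in lborel. indicator {x..y} t *\<^sub>R norm (g' t)
          = indicator {..y} t *\<^sub>R norm (g' t) - indicator {..x} t *\<^sub>R norm (g' t)"
        using AE_lborel_singleton[of x] by eventually_elim (use that in \<open>auto simp: indicator_def\<close>)
      then have "(LINT t|lborel. indicator {x..y} t *\<^sub>R norm (g' t))
          = (LINT t|lborel. indicator {..y} t *\<^sub>R norm (g' t) - indicator {..x} t *\<^sub>R norm (g' t))"
        by (rule integral_cong_AE[rotated 2]) (use int in auto)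
      also have "\<dots> = G y - G x"
        unfolding G_def set_lebesgue_integral_def
        by (intro Bochner_Integration.integral_diff intG) auto
      finally show ?thesis .
    qed
    ultimately show ?thesis by simp
  qed
  have "(\<Sum>i < length xs - 1. norm (g (xs ! Suc i) - g (xs ! i))) \<le> (\<Sum>i < length xs - 1. G (xs ! Suc i) - G (xs ! i))"
    using \<open>sorted xs\<close> by (intro sum_mono step) (auto simp: sorted_iff_nth_mono)
  \<comment> \<open>For the empty list truncated subtraction makes both indices 0, so the two terms
    cancel whatever \<open>xs ! 0\<close> is.\<close>
  also have "\<dots> = G (xs ! (length xs - 1)) - G (xs ! 0)"
    by (rule sum_lessThan_telescope)
  also have "\<dots> \<le> (LINT t|lborel. norm (g' t)) - 0"
    unfolding G_def set_lebesgue_integral_def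
    by (intro diff_mono integral_mono integral_nonneg_AE intG integrable_norm int) (auto simp: indicator_def)
  finally show ?thesis by simp
qed

text \<open>On a short interval \<open>g'\<close> is within \<open>e\<close> of the constant
  \<open>g' x\<close>. The error \<open>e * (y - x)\<close> occurs twice: in comparing the increment
  with \<open>(y - x) *\<^sub>R g' x\<close>, and in comparing the integral of the norm with
  \<open>(y - x) * norm (g' x)\<close>.\<close>

lemma variation_step_ge:
  fixes g g' :: "real \<Rightarrow> complex"
  assumes deriv: "\<And>t. (g has_vector_derivative g' t) (at t)" and cont: "continuous_on UNIV g'"
    and "x \<le> y" and e: "\<And>t. t \<in> {x..y} \<Longrightarrow> norm (g' t - g' x) \<le> e"
  shows "norm (g y - g x) \<ge> integral {x..y} (\<lambda>t. norm (g' t)) - 2 * e * (y - x)"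
proof -
  have e0: "0 \<le> e" using e[of x] \<open>x \<le> y\<close> by simp
  have "(g' has_integral g y - g x) {x..y}"
    using \<open>x \<le> y\<close> by (intro fundamental_theorem_of_calculus) (auto intro: has_vector_derivative_at_within deriv)
  then have "((\<lambda>t. g' t - g' x) has_integral (g y - g x - (y - x) *\<^sub>R g' x)) {x..y}"
    using has_integral_const_real[of "g' x" x y] \<open>x \<le> y\<close> by (auto intro: has_integral_diff)
  from has_integral_bound_real[OF e0 finite.emptyI this]
  have "norm (g y - g x - (y - x) *\<^sub>R g' x) \<le> e * (y - x)"
    using e \<open>x \<le> y\<close> by auto
  moreover have "(y - x) * norm (g' x) \<le> norm (g y - g x) + norm (g y - g x - (y - x) *\<^sub>R g' x)"
    using norm_triangle_ineq4[of "g y - g x" "g y - g x - (y - x) *\<^sub>R g' x"] \<open>x \<le> y\<close> by simp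
  moreover have "integral {x..y} (\<lambda>t. norm (g' t)) \<le> integral {x..y} (\<lambda>t. norm (g' x) + e)"
  proof (rule integral_le)
    show "(\<lambda>t. norm (g' t)) integrable_on {x..y}"
      by (intro integrable_continuous_interval continuous_intros continuous_on_subset[OF cont]) auto
    show "norm (g' t) \<le> norm (g' x) + e" if "t \<in> {x..y}" for t
      using e[OF that] norm_triangle_sub[of "g' t" "g' x"] by linarith
  qed auto
  moreover have "integral {x..y} (\<lambda>t. norm (g' x) + e) = (y - x) * norm (g' x) + e * (y - x)"
    using \<open>x \<le> y\<close> by (simp add: algebra_simps)
  ultimately show ?thesis by linarith
qed

lemma variation_sum_ge:
  fixes g g' :: "real \<Rightarrow> complex"
  assumes deriv: "\<And>t. (g has_vector_derivative g' t) (at t)" and int: "integrable lborel g'"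
    and cont: "continuous_on UNIV g'" and "\<epsilon> > 0"
  shows "\<exists>xs. sorted xs \<and> (\<Sum>i < length xs - 1. norm (g (xs ! Suc i) - g (xs ! i))) > (LINT t|lborel. norm (g' t)) - \<epsilon>"
proof -
  let ?f = "\<lambda>t. norm (g' t)"
  have f_int: "?f integrable_on {x..y}" for x y
    by (intro integrable_continuous_interval continuous_intros continuous_on_subset[OF cont]) auto
  have [measurable]: "g' \<in> borel_measurable borel" by (rule borel_measurable_continuous_onI[OF cont])
  have "(\<lambda>n. LINT t|lborel. indicator {- real n..real n} t *\<^sub>R ?f t) \<longlonglongrightarrow> (LINT t|lborel. ?f t)"
  proof (rule integral_dominated_convergence[where w = ?f])
    show "AE t in lborel. (\<lambda>n. indicator {- real n..real n} t *\<^sub>R ?f t) \<longlonglongrightarrow> ?f t"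
    proof (rule AE_I2, rule tendsto_eventually)
      fix t :: real
      show "\<forall>\<^sub>F n in sequentially. indicator {- real n..real n} t *\<^sub>R ?f t = ?f t"
        using eventually_ge_at_top[of "nat \<lceil>\<bar>t\<bar>\<rceil>"]
        by eventually_elim (auto simp: indicator_def nat_le_iff ceiling_le_iff)
    qed
    show "AE t in lborel. norm (indicator {- real n..real n} t *\<^sub>R ?f t) \<le> ?f t" for n
      by (auto simp: indicator_def)
  qed (use int in auto)
  then have "\<forall>\<^sub>F n in sequentially. (LINT t|lborel. indicator {- real n..real n} t *\<^sub>R ?f t) > (LINT t|lborel. ?f t) - \<epsilon> / 2"
    by (rule order_tendstoD) (use \<open>\<epsilon> > 0\<close> in auto)
  then obtain n where "(LINT t|lborel. indicator {- real n..real n} t *\<^sub>R ?f t) > (LINT t|lborel. ?f t) - \<epsilon> / 2"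
    by (auto simp: eventually_sequentially)
  moreover have "(LINT t:{- real n..real n}|lborel. ?f t) = integral {- real n..real n} ?f"
    unfolding set_integrable_def
    by (rule set_borel_integral_eq_integral)
       (use int in \<open>auto simp: set_integrable_def intro!: integrable_mult_indicator[of _ lborel ?f, unfolded real_scaleR_def]\<close>)
  ultimately have n: "integral {- real n..real n} ?f > (LINT t|lborel. ?f t) - \<epsilon> / 2"
    by (simp add: set_lebesgue_integral_def)
  define N where "N = real n"
  have N: "N \<ge> 0" by (simp add: N_def)
  \<comment> \<open>The error over all steps will be 2 * e * 2 * N, which this choice keeps below
    \<epsilon> / 2; the other half was spent on truncating the line. Using \<open>N + 1\<close>
    avoids division by zero.\<close>
  define e where "e = \<epsilon> / (8 * (N + 1))"
  have e: "e > 0" using \<open>\<epsilon> > 0\<close> N by (simp add: e_def)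
  have "uniformly_continuous_on {-N..N} g'"
    by (intro compact_uniformly_continuous continuous_on_subset[OF cont]) auto
  with e obtain d where d: "d > 0" "\<And>x t. x \<in> {-N..N} \<Longrightarrow> t \<in> {-N..N} \<Longrightarrow> dist t x < d \<Longrightarrow> dist (g' t) (g' x) < e"
    unfolding uniformly_continuous_on_def by metis
  \<comment> \<open>The number of equal steps, so large that the mesh \<open>2 * N / m\<close> is
    below the modulus \<open>d\<close>; the strict inequality also forces \<open>m\<close> to be
    positive when \<open>N = 0\<close>.\<close>
  obtain m where m: "real m > 2 * N / d" using reals_Archimedean2 by blast
  moreover have "2 * N / d \<ge> 0" using N d by simp
  ultimately have m0: "real m > 0" by linarith
  define x where "x i = - N + 2 * N / m * real i" for i :: nat
  have x0: "x 0 = - N" and xm: "x m = N" using m0 by (auto simp: x_def)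
  have xle: "x i \<le> x j" if "i \<le> j" for i j
    using that N m0 unfolding x_def by (intro add_left_mono mult_left_mono) auto
  have xstep: "x (Suc i) - x i = 2 * N / m" for i by (simp add: x_def algebra_simps add_divide_distrib)
  have xsmall: "2 * N / m < d" using m m0 d(1) by (simp add: field_simps)
  define xs where "xs = map x [0..<Suc m]"
  have "sorted xs"
    unfolding xs_def sorted_iff_nth_mono by (auto simp: xle simp del: upt_Suc)
  define P where "P t = integral {-N..t} ?f" for t
  have step: "norm (g (x (Suc i)) - g (x i)) \<ge> P (x (Suc i)) - P (x i) - 2 * e * (2 * N / m)" if "i < m" for i
  proof -
    have 1: "- N \<le> x i" "x i \<le> x (Suc i)" "x (Suc i) \<le> N"
      using xle[of 0 i] xle[of i "Suc i"] xle[of "Suc i" m] that x0 xm by auto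
    have "integral {x i..x (Suc i)} ?f = P (x (Suc i)) - P (x i)"
      using Henstock_Kurzweil_Integration.integral_combine[OF 1(1,2) f_int] by (simp add: P_def)
    moreover have "norm (g (x (Suc i)) - g (x i)) \<ge> integral {x i..x (Suc i)} ?f - 2 * e * (x (Suc i) - x i)"
    proof (rule variation_step_ge[OF deriv cont 1(2)])
      fix t assume "t \<in> {x i..x (Suc i)}"
      then show "norm (g' t - g' (x i)) \<le> e"
        using d(2)[of "x i" t] 1 xstep[of i] xsmall by (auto simp: dist_norm)
    qed
    ultimately show ?thesis by (simp add: xstep)
  qed
  have "(\<Sum>i<m. P (x (Suc i)) - P (x i) - 2 * e * (2 * N / m)) \<le> (\<Sum>i<m. norm (g (x (Suc i)) - g (x i)))"
    by (intro sum_mono step) auto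
  moreover have "(\<Sum>i<m. P (x (Suc i)) - P (x i) - 2 * e * (2 * N / m)) = P N - P (-N) - 4 * e * N"
    unfolding sum_subtractf[of _ "\<lambda>_. 2 * e * (2 * N / m)"] using m0
    by (simp add: sum_lessThan_telescope[of "\<lambda>i. P (x i)"] x0 xm)
  moreover have "P (-N) = 0" by (simp add: P_def)
  moreover have "4 * e * N < \<epsilon> / 2" using \<open>\<epsilon> > 0\<close> N by (simp add: e_def field_simps)
  moreover have "P N > (LINT t|lborel. ?f t) - \<epsilon> / 2" using n by (simp add: P_def N_def)
  moreover have "(\<Sum>i < length xs - 1. norm (g (xs ! Suc i) - g (xs ! i))) = (\<Sum>i<m. norm (g (x (Suc i)) - g (x i)))"
    by (rule sum.cong) (auto simp: xs_def simp del: upt_Suc)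
  ultimately show ?thesis using \<open>sorted xs\<close> by (intro exI[of _ xs]) linarith
qed

lemma tvar_eq_integral:
  fixes g g' :: "real \<Rightarrow> complex"
  assumes "\<And>t. (g has_vector_derivative g' t) (at t)" "integrable lborel g'" "continuous_on UNIV g'"
  shows "tvar g = (LINT t|lborel. norm (g' t))"
proof -
  let ?V = "\<lambda>xs. \<Sum>i < length xs - 1. norm (g (xs ! Suc i) - g (xs ! i))"
  have ub: "?V xs \<le> (LINT t|lborel. norm (g' t))" if "sorted xs" for xs
    using variation_sum_le[OF assms that] .
  then have bdd: "bdd_above (?V ` {xs. sorted xs})" by (auto intro!: bdd_aboveI)
  have "tvar g \<le> (LINT t|lborel. norm (g' t))"
    unfolding tvar_def
  proof (rule cSUP_least)
    show "{xs :: real list. sorted xs} \<noteq> {}" by (auto intro: exI[of _ "[]"])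
  qed (use ub in auto)
  moreover have "(LINT t|lborel. norm (g' t)) \<le> tvar g"
  proof (rule field_le_epsilon)
    fix \<epsilon> :: real assume "\<epsilon> > 0"
    from variation_sum_ge[OF assms this] obtain xs
      where "sorted xs" "?V xs > (LINT t|lborel. norm (g' t)) - \<epsilon>" by auto
    moreover have "?V xs \<le> tvar g"
      unfolding tvar_def using \<open>sorted xs\<close> by (intro cSUP_upper[OF _ bdd]) auto
    ultimately show "(LINT t|lborel. norm (g' t)) \<le> tvar g + \<epsilon>" by simp
  qed
  ultimately show ?thesis by simp
qed

section \<open>Sharpness of the growth estimate\<close>

definition ramp :: "real \<Rightarrow> real" where
  "ramp x = min (max x 0) 1"

lemma ramp_bounds: "0 \<le> ramp x" "ramp x \<le> 1"
  by (auto simp: ramp_def)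

lemma ramp_eq_0: "x \<le> 0 \<Longrightarrow> ramp x = 0" and ramp_eq_1: "x \<ge> 1 \<Longrightarrow> ramp x = 1"
  and ramp_eq_self: "0 \<le> x \<Longrightarrow> x \<le> 1 \<Longrightarrow> ramp x = x"
  by (auto simp: ramp_def)

lemma continuous_ramp: "continuous_on S ramp"
  unfolding ramp_def by (intro continuous_intros)

lemma borel_measurable_ramp [measurable]: "ramp \<in> borel_measurable borel"
  by (intro borel_measurable_continuous_onI continuous_ramp)

lemma ramp_dv_integrable: "integrable lborel (\<lambda>t. of_real (ramp (b * t)) * dv t)"
  by (rule integrable_bounded_mult[where B = 1]) (auto simp: dv_integrable ramp_bounds)

text \<open>Integration by parts: the ramp has slope \<open>b\<close> on [0, 1 / b] and is constant
  elsewhere. The purpose is to pass from \<open>dv\<close>, whose real part changes sign, to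
  \<open>vfun 1\<close>, whose real part does not.\<close>

lemma ramp_integral:
  assumes "b > 0"
  shows "- (LINT t|lborel. of_real (ramp (b * t)) * dv t) = of_real b * integral {0..1 / b} (vfun 1)"
proof -
  let ?I = "{0..1 / b}"
  have v_int: "set_integrable lborel ?I (vfun 1)"
    unfolding set_integrable_def
    by (rule borel_integrable_compact) (auto intro!: continuous_on_subset[OF continuous_vfun])
  have tdv_int: "set_integrable lborel ?I (\<lambda>t. of_real t * dv t)"
    unfolding set_integrable_def
    by (rule borel_integrable_compact) (auto intro!: continuous_intros continuous_on_subset[OF continuous_dv])
  have dv_int: "set_integrable lborel {1 / b<..} dv"
    using dv_integrable by (simp add: set_integrable_def integrable_mult_indicator)
  have "(LINT t|lborel. indicator ?I t *\<^sub>R (of_real t * dv t + vfun 1 t)) = of_real (1 / b) * vfun 1 (1 / b) - of_real 0 * vfun 1 0"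
  proof (rule integral_FTC_Icc)
    fix t :: real
    have "((\<lambda>t. of_real t * vfun 1 t) has_vector_derivative of_real t * dv t + 1 * vfun 1 t) (at t)"
      by (intro has_vector_derivative_mult has_vector_derivative_of_real
            vfun_1_has_vector_derivative) (auto intro!: derivative_eq_intros)
    then show "((\<lambda>t. of_real t * vfun 1 t) has_vector_derivative of_real t * dv t + vfun 1 t) (at t within ?I)"
      by (simp add: has_vector_derivative_at_within)
    show "continuous_on ?I (\<lambda>t. of_real t * dv t + vfun 1 t)"
      by (auto intro!: continuous_intros continuous_on_subset[OF continuous_dv] continuous_on_subset[OF continuous_vfun])
  qed (use assms in simp)
  then have A: "(LINT t:?I|lborel. of_real t * dv t) + (LINT t:?I|lborel. vfun 1 t) = of_real (1 / b) * vfun 1 (1 / b)"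
    using set_integral_add(2)[OF tdv_int v_int] by (simp add: set_lebesgue_integral_def)
  have "(\<lambda>t. of_real (ramp (b * t)) * dv t)
      = (\<lambda>t. of_real b * (indicator ?I t *\<^sub>R (of_real t * dv t)) + indicator {1 / b<..} t *\<^sub>R dv t)"
  proof
    fix t
    consider "t < 0" | "0 \<le> t" "t \<le> 1 / b" | "t > 1 / b" by linarith
    then show "of_real (ramp (b * t)) * dv t
        = of_real b * (indicator ?I t *\<^sub>R (of_real t * dv t)) + indicator {1 / b<..} t *\<^sub>R dv t"
    proof cases
      case 1
      then have "b * t \<le> 0" "t \<le> 1 / b" using assms by (auto simp: mult_le_0_iff intro: order_trans[of t 0])
      with 1 show ?thesis by (simp add: ramp_eq_0)
    next
      case 2
      then have "0 \<le> b * t" "b * t \<le> 1" using assms by (auto simp: field_simps)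
      with 2 show ?thesis by (simp add: ramp_eq_self)
    next
      case 3
      then have "b * t \<ge> 1" using assms by (simp add: field_simps)
      with 3 show ?thesis by (simp add: ramp_eq_1)
    qed
  qed
  then have "(LINT t|lborel. of_real (ramp (b * t)) * dv t)
      = of_real b * (LINT t:?I|lborel. of_real t * dv t) + (LINT t:{1 / b<..}|lborel. dv t)"
    using tdv_int dv_int unfolding set_integrable_def set_lebesgue_integral_def
    by (simp only: Bochner_Integration.integral_add integrable_mult_right integral_mult_right_zero)
  \<comment> \<open>The boundary term at \<open>1 / b\<close> cancels against the integral of
    \<open>dv\<close> over the half line where the ramp is 1.\<close>
  also have "\<dots> = of_real b * (of_real (1 / b) * vfun 1 (1 / b) - (LINT t:?I|lborel. vfun 1 t)) - vfun 1 (1 / b)"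
    unfolding A[symmetric] dv_integral_greaterThan by simp
  also have "\<dots> = - (of_real b * (LINT t:?I|lborel. vfun 1 t))"
    using assms by (simp add: algebra_simps)
  finally show ?thesis
    using set_borel_integral_eq_integral(2)[OF v_int] by simp
qed

text \<open>The linear term is imaginary, so the real part is (1 - cos t) / t^2 away from 0.\<close>

lemma Re_vfun_nonneg: "0 \<le> Re (vfun 1 t)"
  by (auto simp: vfun_def Re_exp Re_divide_of_real)

lemma Re_integral_vfun: "Re (integral {0..a} (vfun 1)) = integral {0..a} (\<lambda>t. Re (vfun 1 t))"
proof -
  have "vfun 1 integrable_on {0..a}"
    by (intro integrable_continuous_interval continuous_on_subset[OF continuous_vfun]) auto
  from integral_linear[OF this bounded_linear_Re] show ?thesis by (simp add: o_def)
qed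

lemma Re_ramp_integral_nonneg:
  assumes "b > 0"
  shows "Re (- (LINT t|lborel. of_real (ramp (b * t)) * dv t)) \<ge> 0"
proof -
  have "0 \<le> integral {0..1 / b} (\<lambda>t. Re (vfun 1 t))"
    by (rule integral_nonneg)
       (auto intro!: integrable_continuous_interval continuous_intros continuous_on_subset[OF continuous_vfun] Re_vfun_nonneg)
  then show ?thesis
    unfolding ramp_integral[OF assms] using assms by (simp add: Re_integral_vfun)
qed

text \<open>A continuous nonnegative function with value 1/2 at 0 has positive integral over [0, 1].
  This number is the uniform lower bound \<open>K\<close> in \<open>growth_sharp\<close>.\<close>

lemma Re_ramp_integral_pos: "Re (- (LINT t|lborel. of_real (ramp t) * dv t)) > 0"
proof -
  have cont: "continuous_on {0..1} (\<lambda>t. Re (vfun 1 t))"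
    by (intro continuous_intros continuous_on_subset[OF continuous_vfun]) auto
  have "integral {0..1} (\<lambda>t. Re (vfun 1 t)) \<noteq> 0"
  proof
    assume "integral {0..1} (\<lambda>t. Re (vfun 1 t)) = 0"
    then have "\<forall>t\<in>{0..1}. Re (vfun 1 t) = 0"
      using integral_eq_0_iff[OF cont] by (auto simp: Re_vfun_nonneg)
    then have "Re (vfun 1 0) = 0" by auto
    then show False by (simp add: vfun_def)
  qed
  moreover have "integral {0..1} (\<lambda>t. Re (vfun 1 t)) \<ge> 0"
    by (rule integral_nonneg) (auto intro!: integrable_continuous_interval cont Re_vfun_nonneg)
  ultimately show ?thesis
    using ramp_integral[of 1] by (simp add: Re_integral_vfun)
qed

section \<open>A primitive built as a weighted series of ramps\<close>

locale ramp_series =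
  fixes S :: "nat \<Rightarrow> real"
  assumes S_ge: "\<And>n. S n \<ge> real n + 1"
begin

text \<open>The assumption on \<open>S\<close> acts in three ways: \<open>S n \<ge> 1\<close> makes
  all ramps equal to 1 from \<open>x = 1\<close> on, \<open>S\<close> tends to infinity, and each
  positive \<open>x\<close> lies in only finitely many of the intervals of
  \<open>fser\<close>.\<close>

lemma S_pos: "S n > 0" and S_ge_1: "S n \<ge> 1"
  using S_ge[of n] by auto

definition Fser :: "real \<Rightarrow> real" where
  "Fser x = (\<Sum>n. (1/2)^n * ramp (S n * x))"

text \<open>The intervals exclude 0, where the series need not converge.\<close>

definition fser :: "real \<Rightarrow> real" where
  "fser x = (\<Sum>n. (1/2)^n * (if x \<in> {0<..1 / S n} then S n else 0))"

lemma term_bounds: "norm ((1/2)^n * ramp (S n * x)) \<le> (1/2)^n"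
  using ramp_bounds[of "S n * x"] by (simp add: abs_mult mult_left_le)

lemma Fser_summable: "summable (\<lambda>n. (1/2)^n * ramp (S n * x))"
  by (rule summable_comparison_test'[of "\<lambda>n. (1/2)^n" 0]) (use term_bounds in \<open>auto simp: summable_geometric\<close>)

lemma Fser_nonpos:
  assumes "x \<le> 0"
  shows "Fser x = 0"
proof -
  have "ramp (S n * x) = 0" for n
    using assms S_pos[of n] by (intro ramp_eq_0) (simp add: mult_le_0_iff)
  then show ?thesis by (simp add: Fser_def)
qed

lemma Fser_ge_1:
  assumes "x \<ge> 1"
  shows "Fser x = 2"
proof -
  have "ramp (S n * x) = 1" for n
    using mult_mono[OF S_ge_1 assms, of n] S_ge_1[of n] by (simp add: ramp_def)
  then show ?thesis by (simp add: Fser_def suminf_geometric)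
qed

lemma continuous_Fser: "continuous_on UNIV Fser"
proof (rule uniform_limit_theorem)
  show "uniform_limit UNIV (\<lambda>N x. \<Sum>n<N. (1/2)^n * ramp (S n * x)) Fser sequentially"
    unfolding Fser_def[abs_def]
    by (rule Weierstrass_m_test[of _ _ "\<lambda>n. (1/2)^n"]) (use term_bounds in \<open>auto simp: summable_geometric\<close>)
  show "\<forall>\<^sub>F N in sequentially. continuous_on UNIV (\<lambda>x. \<Sum>n<N. (1/2)^n * ramp (S n * x))"
    by (intro always_eventually allI continuous_intros continuous_on_compose2[OF continuous_ramp[of UNIV]]) auto
qed auto

lemma Fser_Bc: "(\<lambda>x. complex_of_real (Fser x)) \<in> Bc"
proof -
  have "((\<lambda>x. complex_of_real (Fser x)) \<longlongrightarrow> 0) at_bot"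
    by (rule tendsto_eventually) (use eventually_le_at_bot[of 0] in eventually_elim, simp add: Fser_nonpos)
  moreover have "((\<lambda>x. complex_of_real (Fser x)) \<longlongrightarrow> 2) at_top"
    by (rule tendsto_eventually) (use eventually_ge_at_top[of 1] in eventually_elim, simp add: Fser_ge_1)
  ultimately show ?thesis
    unfolding Bc_def by (auto intro!: continuous_on_of_real continuous_Fser)
qed

lemma fser_term_has_integral:
  "((\<lambda>t. (1/2)^n * (if t \<in> {0<..1 / S n} then S n else 0)) has_integral (1/2)^n * ramp (S n * x)) {..x}"
proof (rule has_integral_mult_right)
  have "((\<lambda>t. S n) has_integral ramp (S n * x)) {0..min x (1 / S n)}"
  proof (cases "x \<le> 0")
    case True
    then have "ramp (S n * x) = 0" using S_pos[of n] by (intro ramp_eq_0) (simp add: mult_le_0_iff)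
    moreover have "min x (1 / S n) = x"
      using order_trans[OF True, of "1 / S n"] S_pos[of n] by (simp add: min_def)
    moreover have "{0..x} = {} \<or> {0..x} = {0}" using True by auto
    ultimately show ?thesis by (auto simp: has_integral_refl)
  next
    case False
    then have "0 \<le> S n * x" using S_pos[of n] by simp
    then have "ramp (S n * x) = S n * min x (1 / S n)"
      using S_pos[of n] by (auto simp: ramp_def min_def max_def field_simps)
    then show ?thesis
      using has_integral_const_real[of "S n" 0 "min x (1 / S n)"] False S_pos[of n] by (simp add: mult.commute)
  qed
  moreover have "{0..min x (1 / S n)} = {0..1 / S n} \<inter> {..x}" by auto
  ultimately have "((\<lambda>t. if t \<in> {0..1 / S n} then S n else 0) has_integral ramp (S n * x)) {..x}"
    by (simp only: has_integral_restrict_Int)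
  \<comment> \<open>Removing 0 from the interval changes the integrand at one point.\<close>
  then show "((\<lambda>t. if t \<in> {0<..1 / S n} then S n else 0) has_integral ramp (S n * x)) {..x}"
    by (rule has_integral_spike_finite[of "{0}", rotated 2]) auto
qed

text \<open>The sum is locally finite: if \<open>x\<close> lies in the n-th interval, then n + 1
  \<le> S n \<le> 1 / x.\<close>

lemma fser_summable: "summable (\<lambda>n. (1/2)^n * (if x \<in> {0<..1 / S n} then S n else 0))"
proof (rule summable_finite[of "{..nat \<lceil>1 / x\<rceil>}"])
  fix n assume "n \<notin> {..nat \<lceil>1 / x\<rceil>}"
  then have "1 / x < real n" by (simp add: not_le) linarith
  moreover have "1 / x \<ge> S n" if "0 < x" "x \<le> 1 / S n"
    using that S_pos[of n] by (simp add: field_simps)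
  ultimately have "\<not> (0 < x \<and> x \<le> 1 / S n)" using S_ge[of n] by linarith
  then show "(1/2)^n * (if x \<in> {0<..1 / S n} then S n else 0) = 0" by auto
qed auto

text \<open>All terms are nonnegative, so monotone convergence applies although \<open>fser\<close>
  may be unbounded near 0. This shows that the distribution with primitive \<open>Fser\<close> is an
  integrable function.\<close>

lemma fser_has_integral: "(fser has_integral Fser x) {..x}"
proof (rule has_integral_monotone_convergence_increasing)
  show "((\<lambda>t. \<Sum>n<k. (1/2)^n * (if t \<in> {0<..1 / S n} then S n else 0)) has_integral
      (\<Sum>n<k. (1/2)^n * ramp (S n * x))) {..x}" for k
    by (intro has_integral_sum fser_term_has_integral) auto
  show "(\<Sum>n<k. (1/2)^n * (if t \<in> {0<..1 / S n} then S n else 0))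
      \<le> (\<Sum>n<Suc k. (1/2)^n * (if t \<in> {0<..1 / S n} then S n else 0))" for k t
    using S_pos[of k] by simp
  show "(\<lambda>k. \<Sum>n<k. (1/2)^n * (if t \<in> {0<..1 / S n} then S n else 0)) \<longlonglongrightarrow> fser t" for t
    unfolding fser_def by (rule summable_LIMSEQ[OF fser_summable])
  show "(\<lambda>k. \<Sum>n<k. (1/2)^n * ramp (S n * x)) \<longlonglongrightarrow> Fser x"
    unfolding Fser_def by (rule summable_LIMSEQ[OF Fser_summable])
qed

lemma fser_has_integral_complex: "((\<lambda>t. complex_of_real (fser t)) has_integral complex_of_real (Fser x)) {..x}"
  using has_integral_linear[where h = complex_of_real, OF fser_has_integral bounded_linear_of_real] by (simp add: o_def)

lemma fser_integrable: "(\<lambda>t. complex_of_real (fser t)) integrable_on UNIV"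
proof -
  have "fser t = 0" if "t > 1" for t
  proof -
    have "1 / S n \<le> 1" for n using S_ge_1[of n] by simp
    then have "\<not> t \<le> 1 / S n" for n using that by (smt (verit))
    then show ?thesis by (simp add: fser_def)
  qed
  then have "(\<lambda>t. complex_of_real (fser t)) = (\<lambda>t. if t \<in> {..1} then complex_of_real (fser t) else 0)"
    by (auto simp: fun_eq_iff)
  moreover have "(\<lambda>t. if t \<in> {..1} then complex_of_real (fser t) else 0) integrable_on UNIV"
    unfolding integrable_restrict_UNIV by (rule has_integral_integrable[OF fser_has_integral_complex])
  ultimately show ?thesis by simp
qed

text \<open>Rescaling by \<open>S m\<close> turns the n-th ramp into one of slope
  \<open>S n / S m\<close>. All of them contribute nonnegatively to the real part, so keeping only
  \<open>n = m\<close>, where the slope is 1, gives a lower bound.\<close>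

lemma Re_Omega_Fser_ge:
  "Re (Omega (\<lambda>x. complex_of_real (Fser x)) (S m))
     \<ge> (S m)\<^sup>2 * ((1/2)^m * Re (- (LINT t|lborel. of_real (ramp t) * dv t)))"
proof -
  define s where "s = S m"
  have s: "s > 0" using S_pos by (simp add: s_def)
  define P where "P N x = (\<Sum>n<N. (1/2)^n * ramp (S n * x))" for N x
  define J where "J b = Re (- (LINT t|lborel. of_real (ramp (b * t)) * dv t))" for b
  have J_nonneg: "J b \<ge> 0" if "b > 0" for b
    unfolding J_def by (rule Re_ramp_integral_nonneg[OF that])
  have P: "(\<lambda>N. P N x) \<longlonglongrightarrow> Fser x" for x
    unfolding Fser_def P_def by (rule summable_LIMSEQ[OF Fser_summable])
  \<comment> \<open>The sum of the geometric series, used as the uniform majorant when the series is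
    exchanged with the integral.\<close>
  have P_bound: "\<bar>P N x\<bar> \<le> 2" for N x
  proof -
    have "0 \<le> P N x" unfolding P_def by (intro sum_nonneg mult_nonneg_nonneg ramp_bounds) auto
    moreover have "P N x \<le> (\<Sum>n<N. (1/2)^n)"
      unfolding P_def by (intro sum_mono) (simp add: mult_left_le ramp_bounds)
    moreover have "(\<Sum>n<N. (1/2)^n) \<le> (\<Sum>n. (1/2::real)^n)"
      by (intro sum_le_suminf) (auto simp: summable_geometric)
    ultimately show ?thesis by (simp add: suminf_geometric)
  qed
  have [measurable]: "P N \<in> borel_measurable borel" for N unfolding P_def by measurable
  have [measurable]: "Fser \<in> borel_measurable borel"
    by (rule borel_measurable_continuous_onI[OF continuous_Fser])
  have "(\<lambda>N. LINT t|lborel. of_real (P N (t / s)) * dv t) \<longlonglongrightarrow> (LINT t|lborel. of_real (Fser (t / s)) * dv t)"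
  proof (rule integral_dominated_convergence[where w = "\<lambda>t. 2 * norm (dv t)"])
    show "AE t in lborel. norm (of_real (P N (t / s)) * dv t) \<le> 2 * norm (dv t)" for N
      using P_bound by (auto simp: norm_mult intro!: mult_right_mono)
    show "AE t in lborel. (\<lambda>N. of_real (P N (t / s)) * dv t) \<longlonglongrightarrow> of_real (Fser (t / s)) * dv t"
      by (intro AE_I2 tendsto_intros P)
  qed (auto simp: dv_integrable)
  then have lim: "(\<lambda>N. Re (- (LINT t|lborel. of_real (P N (t / s)) * dv t))) \<longlonglongrightarrow> Re (- (LINT t|lborel. of_real (Fser (t / s)) * dv t))"
    by (intro tendsto_intros)
  have eq: "Re (- (LINT t|lborel. of_real (P N (t / s)) * dv t)) = (\<Sum>n<N. (1/2)^n * J (S n / s))" for N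
  proof -
    have "(LINT t|lborel. of_real (P N (t / s)) * dv t)
        = (LINT t|lborel. (\<Sum>n<N. of_real ((1/2)^n) * (of_real (ramp ((S n / s) * t)) * dv t)))"
      by (simp add: P_def sum_distrib_right mult.assoc)
    also have "\<dots> = (\<Sum>n<N. of_real ((1/2)^n) * (LINT t|lborel. of_real (ramp ((S n / s) * t)) * dv t))"
      unfolding integral_mult_right_zero[symmetric]
      by (intro Bochner_Integration.integral_sum integrable_mult_right ramp_dv_integrable)
    finally show ?thesis
      by (simp add: J_def sum_negf Re_sum del: of_real_power)
  qed
  have "(1/2)^m * J 1 \<le> Re (- (LINT t|lborel. of_real (Fser (t / s)) * dv t))"
  proof (rule tendsto_lowerbound[OF lim])
    show "\<forall>\<^sub>F N in sequentially. (1/2)^m * J 1 \<le> Re (- (LINT t|lborel. of_real (P N (t / s)) * dv t))"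
      using eventually_gt_at_top[of m]
    proof eventually_elim
      case (elim N)
      have "(1/2)^m * J (S m / s) \<le> (\<Sum>n<N. (1/2)^n * J (S n / s))"
        using elim by (intro member_le_sum) (auto simp: S_pos s intro!: mult_nonneg_nonneg J_nonneg)
      then show ?case unfolding eq using s by (simp add: s_def)
    qed
  qed auto
  then have "s\<^sup>2 * ((1/2)^m * J 1) \<le> s\<^sup>2 * Re (- (LINT t|lborel. of_real (Fser (t / s)) * dv t))"
    by (intro mult_left_mono) auto
  then show ?thesis
    using s by (simp add: Omega_eq_rescaled J_def s_def[symmetric])
qed

end

text \<open>Along \<open>S\<close> the quotient stays above the fixed number \<open>K\<close>: the
  weight 2^-m in the lower bound for \<open>Omega\<close> is absorbed by the choice of
  \<open>S m\<close>.\<close>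

lemma growth_sharp:
  fixes \<psi> :: "real \<Rightarrow> real"
  assumes pos: "\<And>s. s \<ge> 0 \<Longrightarrow> \<psi> s > 0" and lim: "((\<lambda>s. \<psi> s / s^2) \<longlongrightarrow> 0) at_top"
  shows "\<exists>f :: real \<Rightarrow> complex. \<exists>F\<in>Bc. f integrable_on UNIV
            \<and> (\<forall>x. (f has_integral F x) {..x})
            \<and> \<not> ((\<lambda>s. Omega F s / complex_of_real (\<psi> s)) \<longlongrightarrow> 0) at_top"
proof -
  have "\<exists>s. s \<ge> real n + 1 \<and> \<psi> s / s\<^sup>2 < (1/2)^n" for n
  proof -
    have "\<forall>\<^sub>F s in at_top. \<psi> s / s\<^sup>2 < (1/2)^n \<and> s \<ge> real n + 1"
      by (intro eventually_conj order_tendstoD(2)[OF lim] eventually_ge_at_top) auto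
    then show ?thesis by (auto simp: eventually_at_top_linorder)
  qed
  then obtain S where S: "\<And>n. S n \<ge> real n + 1" "\<And>n. \<psi> (S n) / (S n)\<^sup>2 < (1/2)^n" by metis
  interpret ramp_series S by unfold_locales (rule S)
  define F where "F x = complex_of_real (Fser x)" for x
  define K where "K = Re (- (LINT t|lborel. of_real (ramp t) * dv t))"
  have K: "K > 0" unfolding K_def by (rule Re_ramp_integral_pos)
  have big: "norm (Omega F (S m) / of_real (\<psi> (S m))) \<ge> K" for m
  proof -
    have \<psi>: "\<psi> (S m) > 0" by (intro pos less_imp_le S_pos)
    have "\<psi> (S m) * K \<le> ((S m)\<^sup>2 * (1/2)^m) * K"
      using S(2)[of m] S_pos[of m] K by (intro mult_right_mono) (auto simp: field_simps)
    also have "\<dots> \<le> Re (Omega F (S m))"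
      using Re_Omega_Fser_ge[of m] unfolding F_def[abs_def] K_def by (simp add: mult.assoc)
    also have "\<dots> \<le> norm (Omega F (S m))" by (rule complex_Re_le_cmod)
    finally show ?thesis using \<psi> by (simp add: norm_divide field_simps)
  qed
  have "filterlim S at_top sequentially"
    by (rule filterlim_at_top_mono[OF filterlim_real_sequentially]) (auto intro!: always_eventually order_trans[OF _ S(1)])
  have "\<not> ((\<lambda>s. Omega F s / complex_of_real (\<psi> s)) \<longlongrightarrow> 0) at_top"
  proof
    assume "((\<lambda>s. Omega F s / complex_of_real (\<psi> s)) \<longlongrightarrow> 0) at_top"
    from filterlim_compose[OF this \<open>filterlim S at_top sequentially\<close>]
    have "(\<lambda>m. norm (Omega F (S m) / complex_of_real (\<psi> (S m)))) \<longlonglongrightarrow> 0"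
      by (rule tendsto_norm_zero)
    then have "K \<le> 0" by (rule tendsto_lowerbound) (use big in auto)
    with K show False by simp
  qed
  then show ?thesis
    using Fser_Bc fser_integrable fser_has_integral_complex unfolding F_def[abs_def]
    by (intro exI[of _ "\<lambda>t. complex_of_real (fser t)"] bexI[of _ "\<lambda>x. complex_of_real (Fser x)"]) auto
qed

lemma Omega_not_Lipschitz: "\<exists>F\<in>Bc. \<not> (\<exists>L. L-lipschitz_on UNIV (Omega F))"
proof -
  \<comment> \<open>The value 1 below \<open>s = 1\<close> keeps \<psi> positive at 0; only large
    \<open>s\<close> matter for the limits.\<close>
  define \<psi> :: "real \<Rightarrow> real" where "\<psi> s = (if s < 1 then 1 else s * sqrt s)" for s
  have sqrt0: "((\<lambda>s. inverse (sqrt s)) \<longlongrightarrow> 0) at_top"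
    by (intro tendsto_inverse_0_at_top sqrt_at_top)
  have "((\<lambda>s. \<psi> s / s^2) \<longlongrightarrow> 0) at_top"
  proof (rule Lim_transform_eventually[OF sqrt0])
    show "\<forall>\<^sub>F s in at_top. inverse (sqrt s) = \<psi> s / s^2"
      using eventually_ge_at_top[of 1]
    proof eventually_elim
      case (elim s)
      then have "s * s = s * (sqrt s * sqrt s)" by simp
      with elim show ?case by (simp add: \<psi>_def power2_eq_square field_simps)
    qed
  qed
  moreover have "\<psi> s > 0" if "s \<ge> 0" for s using that by (auto simp: \<psi>_def)
  ultimately obtain F where F: "F \<in> Bc" "\<not> ((\<lambda>s. Omega F s / complex_of_real (\<psi> s)) \<longlongrightarrow> 0) at_top"
    using growth_sharp[of \<psi>] by auto
  have False if L: "L-lipschitz_on UNIV (Omega F)" for L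
  proof -
    have "((\<lambda>s. Omega F s / complex_of_real (\<psi> s)) \<longlongrightarrow> 0) at_top"
    proof (rule Lim_null_comparison)
      show "((\<lambda>s. L * inverse (sqrt s)) \<longlongrightarrow> 0) at_top"
        by (rule tendsto_mult_right_zero[OF sqrt0])
      show "\<forall>\<^sub>F s in at_top. norm (Omega F s / complex_of_real (\<psi> s)) \<le> L * inverse (sqrt s)"
        using eventually_ge_at_top[of 1]
      proof eventually_elim
        case (elim s)
        have "norm (Omega F s) \<le> L * s"
          using lipschitz_onD[OF L, of s 0] elim by (simp add: Omega_0 dist_norm)
        with elim show ?case by (simp add: \<psi>_def norm_divide norm_mult field_simps)
      qed
    qed
    with F(2) show False by simp
  qed
  with F(1) show ?thesis by blast
qed

section \<open>Increments\<close>

lemma Holder_integral: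
  fixes f g :: "real \<Rightarrow> complex"
  assumes p: "1 < p" and q: "1 < q" and pq: "1 / p + 1 / q = 1"
    and [measurable]: "f \<in> borel_measurable borel" "g \<in> borel_measurable borel"
    and f: "integrable lborel (\<lambda>t. norm (f t) powr p)" and g: "integrable lborel (\<lambda>t. norm (g t) powr q)"
  shows "integrable lborel (\<lambda>t. f t * g t)"
    and "(LINT t|lborel. norm (f t * g t)) \<le> Lpnorm p f * Lpnorm q g"
proof -
  \<comment> \<open>Young's inequality for the functions themselves gives integrability; below it is
    applied again after normalisation to get the sharp product of norms.\<close>
  have young: "norm (f t * g t) \<le> norm (f t) powr p / p + norm (g t) powr q / q" for t
    unfolding norm_mult by (rule Youngs_inequality[OF _ _ pq]) (use p q in auto)
  show int: "integrable lborel (\<lambda>t. f t * g t)"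
  proof (rule Bochner_Integration.integrable_bound)
    show "integrable lborel (\<lambda>t. norm (f t) powr p / p + norm (g t) powr q / q)"
      using f g by auto
    show "AE t in lborel. norm (f t * g t) \<le> norm (norm (f t) powr p / p + norm (g t) powr q / q)"
      using order_trans[OF young abs_ge_self] by auto
  qed auto
  define A B where "A = (LINT t|lborel. norm (f t) powr p)" and "B = (LINT t|lborel. norm (g t) powr q)"
  have AB: "A \<ge> 0" "B \<ge> 0" by (auto simp: A_def B_def)
  show "(LINT t|lborel. norm (f t * g t)) \<le> Lpnorm p f * Lpnorm q g"
  \<comment> \<open>If one of the norms vanishes, normalisation is impossible, but the product is
    then zero almost everywhere.\<close>
  proof (cases "A = 0 \<or> B = 0")
    case True
    have "AE t in lborel. norm (f t * g t) = 0"
    proof (cases "A = 0")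
      case True
      then have "AE t in lborel. norm (f t) powr p = 0"
        using integral_nonneg_eq_0_iff_AE[OF f] by (auto simp: A_def)
      then show ?thesis by eventually_elim auto
    next
      case False
      with \<open>A = 0 \<or> B = 0\<close> have "AE t in lborel. norm (g t) powr q = 0"
        using integral_nonneg_eq_0_iff_AE[OF g] by (auto simp: B_def)
      then show ?thesis by eventually_elim auto
    qed
    then have "(LINT t|lborel. norm (f t * g t)) = 0"
      using integral_nonneg_eq_0_iff_AE[OF integrable_norm[OF int]] by auto
    then show ?thesis by (simp add: Lpnorm_def)
  next
    case False
    with AB have AB: "A > 0" "B > 0" by auto
    define a b where "a = Lpnorm p f" and "b = Lpnorm q g"
    have ab: "a > 0" "b > 0" "a powr p = A" "b powr q = B"
      using AB p q by (auto simp: a_def b_def Lpnorm_def A_def[symmetric] B_def[symmetric] powr_powr)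
    have pt: "norm (f t * g t) / (a * b) \<le> norm (f t) powr p / (p * A) + norm (g t) powr q / (q * B)" for t
    proof -
      have "norm (f t * g t) / (a * b) = (norm (f t) / a) * (norm (g t) / b)"
        by (simp add: norm_mult)
      also have "\<dots> \<le> (norm (f t) / a) powr p / p + (norm (g t) / b) powr q / q"
        by (rule Youngs_inequality[OF _ _ pq]) (use p q ab in auto)
      also have "\<dots> = norm (f t) powr p / (p * A) + norm (g t) powr q / (q * B)"
        using ab by (simp add: powr_divide mult.commute)
      finally show ?thesis .
    qed
    have "(LINT t|lborel. norm (f t * g t) / (a * b)) \<le> (LINT t|lborel. norm (f t) powr p / (p * A) + norm (g t) powr q / (q * B))"
      by (rule integral_mono) (use pt int f g in auto)
    also have "\<dots> = A / (p * A) + B / (q * B)"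
      using f g by (simp add: A_def B_def)
    also have "\<dots> = 1" using AB pq by simp
    finally have "(LINT t|lborel. norm (f t * g t)) / (a * b) \<le> 1" by simp
    then show ?thesis using ab by (simp add: a_def b_def)
  qed
qed

lemma Lpnorm_scale:
  fixes f :: "real \<Rightarrow> complex"
  assumes "p > 0" "s \<noteq> 0"
  shows "Lpnorm p (\<lambda>t. a * f (s * t)) = norm a * \<bar>s\<bar> powr (- 1 / p) * Lpnorm p f"
proof -
  have "(LINT t|lborel. norm (f t) powr p) = \<bar>s\<bar> * (LINT t|lborel. norm (f (s * t)) powr p)"
    using lborel_integral_real_affine[of s "\<lambda>t. norm (f t) powr p" 0] assms by simp
  then have "(LINT t|lborel. norm (a * f (s * t)) powr p) = norm a powr p * ((LINT t|lborel. norm (f t) powr p) / \<bar>s\<bar>)"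
    using assms by (simp add: norm_mult powr_mult)
  also have "\<dots> powr (1 / p) = norm a * ((LINT t|lborel. norm (f t) powr p) powr (1 / p) / \<bar>s\<bar> powr (1 / p))"
    using assms by (simp add: powr_mult powr_divide powr_powr)
  finally show ?thesis
    using assms by (simp add: Lpnorm_def powr_minus divide_inverse)
qed

lemma powr_norm_scale_integrable:
  fixes f :: "real \<Rightarrow> complex"
  assumes "integrable lborel (\<lambda>t. norm (f t) powr p)" "s \<noteq> 0"
  shows "integrable lborel (\<lambda>t. norm (a * f (s * t)) powr p)"
  using lborel_integrable_real_affine[OF assms, of 0] by (simp add: norm_mult powr_mult)

lemma powr_norm_integrable_decay:
  fixes f :: "real \<Rightarrow> complex"
  assumes "1 < p" and [measurable]: "f \<in> borel_measurable borel" and f: "\<And>t. norm (f t) \<le> 4 * decay t"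
  shows "integrable lborel (\<lambda>t. norm (f t) powr p)"
proof (rule Bochner_Integration.integrable_bound)
  show "integrable lborel (\<lambda>t. 4 powr p * decay t powr p)"
    by (intro integrable_mult_right decay_powr_integrable assms)
  show "AE t in lborel. norm (norm (f t) powr p) \<le> norm (4 powr p * decay t powr p)"
    using powr_mono2[OF _ norm_ge_zero f, of p] assms(1) decay_pos
    by (auto simp: powr_mult less_imp_le)
qed auto

text \<open>By \<open>dv_add\<close> the contribution of \<open>v\<^sub>s\<close> cancels in the
  difference, leaving \<open>v\<^sub>h\<close> and the two product terms. Their integrals are left
  unevaluated because (c) and (e) estimate them differently.\<close>

lemma norm_Omega_diff_le:
  assumes F: "F \<in> Bc"
    and 1: "integrable lborel (\<lambda>t. ufun h t * (of_real (s\<^sup>2) * du (s * t)))"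
    and 2: "integrable lborel (\<lambda>t. of_real (h\<^sup>2) * du (h * t) * ufun s t)"
  shows "norm (Omega F (s + h) - Omega F s) \<le> alex F * ((LINT t|lborel. norm (dv t)) * h\<^sup>2
      + (LINT t|lborel. norm (ufun h t * (of_real (s\<^sup>2) * du (s * t))))
      + (LINT t|lborel. norm (of_real (h\<^sup>2) * du (h * t) * ufun s t)))"
proof -
  let ?A = "\<lambda>t. ufun h t * (of_real (s\<^sup>2) * du (s * t))" and ?B = "\<lambda>t. of_real (h\<^sup>2) * du (h * t) * ufun s t"
  let ?V = "\<lambda>s t. complex_of_real (s^3) * dv (s * t)"
  define D where "D t = ?V h t + (?A t + ?B t)" for t
  have D: "integrable lborel D"
    unfolding D_def by (intro Bochner_Integration.integrable_add dv_scale_integrable 1 2)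
  note int = integrable_bounded_mult[OF Bc_measurable[OF F] norm_le_alex[OF F]]
  have "Omega F (s + h) = - (LINT t|lborel. F t * ?V s t + F t * D t)"
    unfolding Omega_eq dv_add D_def by (simp add: algebra_simps)
  also have "\<dots> = - ((LINT t|lborel. F t * ?V s t) + (LINT t|lborel. F t * D t))"
    by (subst Bochner_Integration.integral_add[OF int[OF dv_scale_integrable] int[OF D]]) simp
  finally have "Omega F (s + h) - Omega F s = - (LINT t|lborel. F t * D t)"
    by (simp add: Omega_eq)
  then have "norm (Omega F (s + h) - Omega F s) \<le> alex F * (LINT t|lborel. norm (D t))"
    using norm_integral_bounded_mult_le[OF Bc_measurable[OF F] norm_le_alex[OF F] D] by simp
  also have "(LINT t|lborel. norm (D t)) \<le> (LINT t|lborel. norm (?V h t) + (norm (?A t) + norm (?B t)))"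
  proof (rule integral_mono)
    show "norm (D t) \<le> norm (?V h t) + (norm (?A t) + norm (?B t))" for t
      unfolding D_def by (intro order_trans[OF norm_triangle_ineq] add_left_mono norm_triangle_ineq)
  qed (intro Bochner_Integration.integrable_add integrable_norm dv_scale_integrable 1 2 D)+
  also have "\<dots> = (LINT t|lborel. norm (?V h t)) + ((LINT t|lborel. norm (?A t)) + (LINT t|lborel. norm (?B t)))"
    by (subst Bochner_Integration.integral_add, intro integrable_norm dv_scale_integrable,
        intro Bochner_Integration.integrable_add integrable_norm 1 2,
        subst Bochner_Integration.integral_add, intro integrable_norm 1, intro integrable_norm 2, rule refl)
  also have "(LINT t|lborel. norm (?V h t)) = (LINT t|lborel. norm (dv t)) * h\<^sup>2"
    unfolding dv_norm_scale_integral by simp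
  finally show ?thesis
    by (simp add: add.assoc mult_left_mono alex_nonneg[OF F])
qed

lemma tvar_vfun: "tvar (vfun 1) = (LINT t|lborel. norm (dv t))"
  by (rule tvar_eq_integral[OF vfun_1_has_vector_derivative dv_integrable continuous_dv])

text \<open>In each product the factor scaled by \<open>h\<close> is measured in the \<rho>-norm and
  the factor scaled by \<open>s\<close> in the \<sigma>-norm; the powers of |h| and |s| are then
  pure scaling.\<close>

lemma Omega_diff_Holder:
  assumes \<rho>: "1 < \<rho>" and conj: "1 / \<rho> + 1 / \<sigma> = 1" and F: "F \<in> Bc"
  shows "norm (Omega F (s + h) - Omega F s)
            \<le> alex F * (tvar (vfun 1) * h^2
               + Lpnorm \<rho> du * Lpnorm \<sigma> (ufun 1) * \<bar>h\<bar> powr (2 - 1 / \<rho>) * \<bar>s\<bar> powr (1 / \<rho>)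
               + Lpnorm \<rho> (ufun 1) * Lpnorm \<sigma> du * \<bar>h\<bar> powr (1 - 1 / \<rho>) * \<bar>s\<bar> powr (1 + 1 / \<rho>))"
proof -
  \<comment> \<open>Scaling of the norms needs nonzero parameters. For \<open>s = 0\<close> the
    estimate follows from the quadratic bound, since \<open>Omega F 0 = 0\<close>.\<close>
  consider "h = 0" | "s = 0" | "h \<noteq> 0" "s \<noteq> 0" by blast
  then show ?thesis
  proof cases
    case 1
    then show ?thesis by simp
  next
    case 2
    then show ?thesis
      using norm_Omega_le[OF F, of h] by (simp add: Omega_0 tvar_vfun mult_ac)
  next
    case 3
    have "1 / \<sigma> = 1 - 1 / \<rho>" using conj by simp
    moreover have "0 < 1 - 1 / \<rho>" "1 - 1 / \<rho> < 1" using \<rho> by auto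
    ultimately have "0 < 1 / \<sigma>" "1 / \<sigma> < 1" by auto
    then have \<sigma>: "1 < \<sigma>" by (simp add: divide_less_eq split: if_splits)
    have \<sigma>': "1 / \<sigma> = 1 - 1 / \<rho>" using conj by simp
    note u = powr_norm_integrable_decay[OF _ borel_measurable_ufun norm_ufun_le_decay]
    note du = powr_norm_integrable_decay[OF _ borel_measurable_du norm_du_le_decay]
    have [measurable]: "ufun s \<in> borel_measurable borel" "ufun h \<in> borel_measurable borel"
      unfolding ufun_scale[of s, abs_def] ufun_scale[of h, abs_def] by measurable
    have us: "integrable lborel (\<lambda>t. norm (ufun s t) powr p)" if "1 < p" "s \<noteq> 0" for p s
      unfolding ufun_scale[of s] by (rule powr_norm_scale_integrable[OF u[OF that(1)] that(2)])
    have dus: "integrable lborel (\<lambda>t. norm (of_real (s\<^sup>2) * du (s * t)) powr p)" if "1 < p" "s \<noteq> 0" for p s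
      by (rule powr_norm_scale_integrable[OF du[OF that(1)] that(2)])
    note H1 = Holder_integral[OF \<rho> \<sigma> conj _ _ us[OF \<rho> 3(1)] dus[OF \<sigma> 3(2)]]
    note H2 = Holder_integral[OF \<rho> \<sigma> conj _ _ dus[OF \<rho> 3(1)] us[OF \<sigma> 3(2)]]
    \<comment> \<open>Scaling gives the exponents 1 - 1/\<sigma> and 2 - 1/\<sigma> for |s|, which
      conjugacy turns into 1/\<rho> and 1 + 1/\<rho>.\<close>
    have L: "Lpnorm \<rho> (ufun h) = \<bar>h\<bar> powr (1 - 1 / \<rho>) * Lpnorm \<rho> (ufun 1)"
      "Lpnorm \<rho> (\<lambda>t. of_real (h\<^sup>2) * du (h * t)) = \<bar>h\<bar> powr (2 - 1 / \<rho>) * Lpnorm \<rho> du"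
      "Lpnorm \<sigma> (ufun s) = \<bar>s\<bar> powr (1 / \<rho>) * Lpnorm \<sigma> (ufun 1)"
      "Lpnorm \<sigma> (\<lambda>t. of_real (s\<^sup>2) * du (s * t)) = \<bar>s\<bar> powr (1 + 1 / \<rho>) * Lpnorm \<sigma> du"
    proof -
      have pw: "\<bar>x\<bar> * \<bar>x\<bar> powr (- a) = \<bar>x\<bar> powr (1 - a)" "\<bar>x\<bar>\<^sup>2 * \<bar>x\<bar> powr (- a) = \<bar>x\<bar> powr (2 - a)" if "x \<noteq> 0" for x a :: real
        using that powr_add[of "\<bar>x\<bar>" 1 "- a"] powr_add[of "\<bar>x\<bar>" 2 "- a"] by auto
      show "Lpnorm \<rho> (ufun h) = \<bar>h\<bar> powr (1 - 1 / \<rho>) * Lpnorm \<rho> (ufun 1)"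
        unfolding ufun_scale[of h, abs_def]
        using Lpnorm_scale[of \<rho> h "of_real h" "ufun 1"] \<rho> 3 pw(1)[of h "1 / \<rho>"] by simp
      show "Lpnorm \<sigma> (ufun s) = \<bar>s\<bar> powr (1 / \<rho>) * Lpnorm \<sigma> (ufun 1)"
        unfolding ufun_scale[of s, abs_def]
        using Lpnorm_scale[of \<sigma> s "of_real s" "ufun 1"] \<sigma> 3 pw(1)[of s "1 / \<sigma>"] \<sigma>' by simp
      show "Lpnorm \<rho> (\<lambda>t. of_real (h\<^sup>2) * du (h * t)) = \<bar>h\<bar> powr (2 - 1 / \<rho>) * Lpnorm \<rho> du"
        using Lpnorm_scale[of \<rho> h "of_real (h\<^sup>2)" du] \<rho> 3 pw(2)[of h "1 / \<rho>"] by (simp add: norm_power)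
      show "Lpnorm \<sigma> (\<lambda>t. of_real (s\<^sup>2) * du (s * t)) = \<bar>s\<bar> powr (1 + 1 / \<rho>) * Lpnorm \<sigma> du"
        using Lpnorm_scale[of \<sigma> s "of_real (s\<^sup>2)" du] \<sigma> 3 pw(2)[of s "1 / \<sigma>"] \<sigma>' by (simp add: norm_power)
    qed
    have "norm (Omega F (s + h) - Omega F s) \<le> alex F * ((LINT t|lborel. norm (dv t)) * h\<^sup>2
      + (LINT t|lborel. norm (ufun h t * (of_real (s\<^sup>2) * du (s * t))))
      + (LINT t|lborel. norm (of_real (h\<^sup>2) * du (h * t) * ufun s t)))"
      by (rule norm_Omega_diff_le[OF F H1(1) H2(1)]) auto
    also have "\<dots> \<le> alex F * ((LINT t|lborel. norm (dv t)) * h\<^sup>2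
      + Lpnorm \<rho> (ufun h) * Lpnorm \<sigma> (\<lambda>t. of_real (s\<^sup>2) * du (s * t))
      + Lpnorm \<rho> (\<lambda>t. of_real (h\<^sup>2) * du (h * t)) * Lpnorm \<sigma> (ufun s))"
      by (intro mult_left_mono add_mono H1(2) H2(2) alex_nonneg[OF F] order_refl) auto
    finally show ?thesis unfolding L tvar_vfun by (simp only: mult_ac add_ac)
  qed
qed

lemma Omega_Holder_continuous:
  assumes F: "F \<in> Bc" and \<alpha>: "0 < \<alpha>" "\<alpha> < 1"
  shows "\<exists>M. \<forall>x\<in>{a..b}. \<forall>y\<in>{a..b}. norm (Omega F x - Omega F y) \<le> M * \<bar>x - y\<bar> powr \<alpha>"
proof -
  \<comment> \<open>Chosen so that 1 - 1/\<rho> = \<alpha>. The powers of |h| are then 2, 1 +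
    \<alpha> and \<alpha>; the last is the target, and the excess in the other two is absorbed by
    |h| \<le> b - a.\<close>
  define \<rho> \<sigma> where "\<rho> = 1 / (1 - \<alpha>)" and "\<sigma> = 1 / \<alpha>"
  have \<rho>: "1 < \<rho>" "1 / \<rho> + 1 / \<sigma> = 1" "1 / \<rho> = 1 - \<alpha>"
    using \<alpha> by (auto simp: \<rho>_def \<sigma>_def)
  define c0 c1 c2 where "c0 = tvar (vfun 1)" and "c1 = Lpnorm \<rho> du * Lpnorm \<sigma> (ufun 1)"
    and "c2 = Lpnorm \<rho> (ufun 1) * Lpnorm \<sigma> du"
  have c: "0 \<le> c0" "0 \<le> c1" "0 \<le> c2"
    by (auto simp: c0_def c1_def c2_def tvar_vfun Lpnorm_def)
  define R where "R = max \<bar>a\<bar> \<bar>b\<bar>"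
  define M where "M = alex F * (c0 * (b - a) powr (2 - \<alpha>) + c1 * (b - a) * R powr (1 - \<alpha>) + c2 * R powr (2 - \<alpha>))"
  have "norm (Omega F x - Omega F y) \<le> M * \<bar>x - y\<bar> powr \<alpha>" if xy: "x \<in> {a..b}" "y \<in> {a..b}" for x y
  proof -
    define h where "h = x - y"
    have h: "\<bar>h\<bar> \<le> b - a" and y: "\<bar>y\<bar> \<le> R" using xy by (auto simp: h_def R_def)
    have "norm (Omega F x - Omega F y) \<le> alex F * (c0 * h\<^sup>2 + c1 * \<bar>h\<bar> powr (1 + \<alpha>) * \<bar>y\<bar> powr (1 - \<alpha>)
        + c2 * \<bar>h\<bar> powr \<alpha> * \<bar>y\<bar> powr (2 - \<alpha>))"
      using Omega_diff_Holder[OF \<rho>(1,2) F, of y h] unfolding \<rho>(3) c0_def c1_def c2_def h_def by simp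
    also have "\<dots> \<le> alex F * (c0 * ((b - a) powr (2 - \<alpha>) * \<bar>h\<bar> powr \<alpha>) + c1 * ((b - a) * \<bar>h\<bar> powr \<alpha>) * R powr (1 - \<alpha>)
        + c2 * \<bar>h\<bar> powr \<alpha> * R powr (2 - \<alpha>))"
    proof (intro mult_left_mono add_mono mult_mono)
      have "h\<^sup>2 = \<bar>h\<bar> powr (2 - \<alpha>) * \<bar>h\<bar> powr \<alpha>"
        by (cases "h = 0") (simp_all add: powr_add[symmetric])
      also have "\<dots> \<le> (b - a) powr (2 - \<alpha>) * \<bar>h\<bar> powr \<alpha>"
        using \<alpha> h by (intro mult_right_mono powr_mono2) auto
      finally show "h\<^sup>2 \<le> (b - a) powr (2 - \<alpha>) * \<bar>h\<bar> powr \<alpha>" .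
      have "\<bar>h\<bar> powr (1 + \<alpha>) = \<bar>h\<bar> * \<bar>h\<bar> powr \<alpha>"
        by (cases "h = 0") (simp_all add: powr_add)
      also have "\<dots> \<le> (b - a) * \<bar>h\<bar> powr \<alpha>" using h by (intro mult_right_mono) auto
      finally show "\<bar>h\<bar> powr (1 + \<alpha>) \<le> (b - a) * \<bar>h\<bar> powr \<alpha>" .
      show "\<bar>y\<bar> powr (1 - \<alpha>) \<le> R powr (1 - \<alpha>)" "\<bar>y\<bar> powr (2 - \<alpha>) \<le> R powr (2 - \<alpha>)"
        using \<alpha> y by (auto intro!: powr_mono2)
      show "0 \<le> c1 * ((b - a) * \<bar>h\<bar> powr \<alpha>)" using c h by (intro mult_nonneg_nonneg) auto
    qed (use c alex_nonneg[OF F] h in \<open>auto intro!: mult_nonneg_nonneg\<close>)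
    also have "\<dots> = M * \<bar>h\<bar> powr \<alpha>" unfolding M_def by (simp only: ring_distribs mult_ac)
    finally show ?thesis by (simp add: h_def)
  qed
  then show ?thesis by blast
qed

lemma continuous_Omega:
  assumes F: "F \<in> Bc"
  shows "continuous_on UNIV (Omega F)"
proof -
  have "isCont (Omega F) x" for x
  proof -
    obtain M where M: "\<And>y. y \<in> {x - 1..x + 1} \<Longrightarrow> norm (Omega F y - Omega F x) \<le> M * \<bar>y - x\<bar> powr (1/2)"
    proof -
      obtain M where "\<forall>y\<in>{x - 1..x + 1}. \<forall>z\<in>{x - 1..x + 1}. norm (Omega F y - Omega F z) \<le> M * \<bar>y - z\<bar> powr (1/2)"
        using Omega_Holder_continuous[OF F, of "1/2" "x - 1" "x + 1"] by auto
      then show thesis by (intro that[of M]) auto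
    qed
    have "((\<lambda>y. Omega F y - Omega F x) \<longlongrightarrow> 0) (at x)"
    proof (rule Lim_null_comparison)
      show "\<forall>\<^sub>F y in at x. norm (Omega F y - Omega F x) \<le> M * \<bar>y - x\<bar> powr (1/2)"
        unfolding eventually_at by (rule exI[of _ 1]) (auto intro!: M simp: dist_real_def)
      have "((\<lambda>y. M * \<bar>y - x\<bar> powr (1/2)) \<longlongrightarrow> M * \<bar>x - x\<bar> powr (1/2)) (at x)"
        by (rule tendsto_mult[OF tendsto_const], rule tendsto_powr') (auto intro!: tendsto_eq_intros)
      then show "((\<lambda>y. M * \<bar>y - x\<bar> powr (1/2)) \<longlongrightarrow> 0) (at x)" by simp
    qed
    then show ?thesis unfolding isCont_def by (rule LIM_zero_cancel)
  qed
  then show ?thesis by (simp add: continuous_at_imp_continuous_on)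
qed

section \<open>The logarithmic modulus of continuity\<close>

lemma abs_reciprocal_integral:
  fixes H :: real
  assumes "H \<ge> 1"
  shows "integrable lborel (\<lambda>t. indicator {t. 1 \<le> \<bar>t\<bar> \<and> \<bar>t\<bar> \<le> H} t / \<bar>t\<bar>)" (is "integrable _ ?L")
    and "(LINT t|lborel. indicator {t. 1 \<le> \<bar>t\<bar> \<and> \<bar>t\<bar> \<le> H} t / \<bar>t\<bar>) = 2 * ln H"
proof -
  let ?g = "\<lambda>t::real. indicator {1..H} t *\<^sub>R (1 / t)"
  have g: "integrable lborel ?g"
    by (rule borel_integrable_compact) (auto intro!: continuous_intros)
  have "integral\<^sup>L lborel ?g = ln H - ln 1"
  proof (rule integral_FTC_Icc[OF assms])
    show "(ln has_vector_derivative 1 / t) (at t within {1..H})" if "1 \<le> t" for t :: real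
      using that by (auto intro!: derivative_eq_intros simp: has_real_derivative_iff_has_vector_derivative[symmetric])
  qed (auto intro!: continuous_intros)
  then have gi: "integral\<^sup>L lborel ?g = ln H" by simp
  have g': "integrable lborel (\<lambda>t. ?g (- t))"
    using lborel_integrable_real_affine[OF g, of "-1" 0] by simp
  have gi': "(LINT t|lborel. ?g (- t)) = ln H"
    using lborel_integral_real_affine[of "-1" ?g 0] gi by simp
  \<comment> \<open>The two reflected halves are disjoint because \<open>t\<close> stays away from
    0. With \<open>H = 1 / \<bar>h\<bar>\<close> this integral becomes the logarithm in (c).\<close>
  have eq: "?L = (\<lambda>t. ?g t + ?g (- t))"
    by (auto simp: fun_eq_iff indicator_def)
  show "integrable lborel ?L"
    unfolding eq by (intro Bochner_Integration.integrable_add g g')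
  show "integral\<^sup>L lborel ?L = 2 * ln H"
    unfolding eq Bochner_Integration.integral_add[OF g g'] gi gi' by simp
qed

text \<open>It lets a constant bound on |t| \<le> 1 be absorbed into a multiple of the integrable
  function \<open>(decay t)\<^sup>2\<close>.\<close>

lemma decay_square_ge: "1 \<le> 4 * (decay t)\<^sup>2" if "\<bar>t\<bar> \<le> 1"
proof -
  have "1 / 2 \<le> decay t" using that by (simp add: decay_def field_simps)
  from power_mono[OF this, of 2] show ?thesis by (simp add: power_divide)
qed

lemma recip_le_decay: "1 / \<bar>t\<bar> \<le> 2 * decay t" if "\<bar>t\<bar> \<ge> 1"
  using that by (simp add: decay_def field_simps)

text \<open>One factor |a| is traded for a bound by 1 / |t| that is uniform in the scale
  \<open>a\<close>.\<close>

lemma abs_times_decay_le: "\<bar>a\<bar> * decay (a * t) \<le> 1 / \<bar>t\<bar>" if "t \<noteq> 0"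
  using that abs_times_decay_le_1[of "a * t"] by (simp add: field_simps abs_mult)

text \<open>No logarithm arises here: of the two factors |h|, one is kept and the other turns
  \<open>decay (h * t)\<close> into 1 / |t|, so with \<open>\<bar>s\<bar> * decay (s * t)\<close>
  the product decays quadratically for all |t| > 1.\<close>

lemma decay_product_le:
  assumes "\<bar>h\<bar> \<le> 1"
  shows "h\<^sup>2 * decay (h * t) * (\<bar>s\<bar> * decay (s * t)) \<le> 4 * (s\<^sup>2 + 1) * \<bar>h\<bar> * (decay t)\<^sup>2"
proof (cases "\<bar>t\<bar> \<le> 1")
  case True
  have s: "\<bar>s\<bar> \<le> s\<^sup>2 + 1" using sum_squares_bound[of "\<bar>s\<bar>" 1] by simp
  have "h\<^sup>2 * decay (h * t) * (\<bar>s\<bar> * decay (s * t)) \<le> (\<bar>h\<bar> * 1) * ((s\<^sup>2 + 1) * 1)"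
  proof (intro mult_mono decay_le_1 s)
    show "h\<^sup>2 \<le> \<bar>h\<bar>" using mult_left_mono[OF assms, of "\<bar>h\<bar>"] by (simp add: power2_eq_square abs_mult[symmetric])
  qed (auto intro!: mult_nonneg_nonneg simp: decay_pos less_imp_le)
  also have "\<dots> \<le> (\<bar>h\<bar> * (s\<^sup>2 + 1)) * (4 * (decay t)\<^sup>2)"
    using mult_left_mono[OF decay_square_ge[OF True], of "\<bar>h\<bar> * (s\<^sup>2 + 1)"] by simp
  finally show ?thesis by (simp only: mult_ac)
next
  case False
  then have t: "t \<noteq> 0" "\<bar>t\<bar> \<ge> 1" by auto
  have "h\<^sup>2 * decay (h * t) * (\<bar>s\<bar> * decay (s * t)) = \<bar>h\<bar> * ((\<bar>h\<bar> * decay (h * t)) * (\<bar>s\<bar> * decay (s * t)))"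
    by (simp add: power2_eq_square abs_mult[symmetric] mult.assoc[symmetric])
  also have "\<dots> \<le> \<bar>h\<bar> * ((2 * decay t) * (2 * decay t))"
    by (intro mult_left_mono mult_mono order_trans[OF abs_times_decay_le[OF t(1)] recip_le_decay[OF t(2)]])
       (auto simp: decay_pos less_imp_le)
  also have "\<dots> = 1 * (4 * \<bar>h\<bar> * (decay t)\<^sup>2)" by (simp add: power2_eq_square)
  also have "\<dots> \<le> (s\<^sup>2 + 1) * (4 * \<bar>h\<bar> * (decay t)\<^sup>2)" by (intro mult_right_mono) auto
  finally show ?thesis by (simp only: mult_ac)
qed

text \<open>Here the single factor |h| must be kept. The first term covers |t| \<le> 1. In the
  middle range \<open>decay (h * t)\<close> is bounded only by 1, which leaves 1 / |t| in the third
  term. Beyond 1 / |h| it does decay, and the second term takes over.\<close>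

lemma decay_product_le_log:
  assumes "0 < \<bar>h\<bar>" "\<bar>h\<bar> \<le> 1"
  shows "\<bar>h\<bar> * decay (h * t) * (s\<^sup>2 * decay (s * t))
    \<le> 4 * (s\<^sup>2 + 1) * \<bar>h\<bar> * (decay t)\<^sup>2 + 4 * \<bar>s\<bar> * h\<^sup>2 * (decay (h * t))\<^sup>2
      + \<bar>s\<bar> * \<bar>h\<bar> * (indicator {t. 1 \<le> \<bar>t\<bar> \<and> \<bar>t\<bar> \<le> 1 / \<bar>h\<bar>} t / \<bar>t\<bar>)"
    (is "?l \<le> ?A + ?B + ?C")
proof -
  have s2: "s\<^sup>2 = \<bar>s\<bar> * \<bar>s\<bar>" by (simp add: power2_eq_square)
  have nonneg: "0 \<le> ?A" "0 \<le> ?B" "0 \<le> ?C" by auto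
  consider "\<bar>t\<bar> \<le> 1" | "1 \<le> \<bar>t\<bar>" "\<bar>t\<bar> \<le> 1 / \<bar>h\<bar>" | "1 < \<bar>t\<bar>" "1 / \<bar>h\<bar> \<le> \<bar>t\<bar>" by linarith
  then show ?thesis
  proof cases
    case 1
    have "?l \<le> (\<bar>h\<bar> * 1) * ((s\<^sup>2 + 1) * 1)"
      by (intro mult_mono decay_le_1) (auto intro!: mult_nonneg_nonneg simp: decay_pos less_imp_le)
    also have "\<dots> \<le> (\<bar>h\<bar> * (s\<^sup>2 + 1)) * (4 * (decay t)\<^sup>2)"
      using mult_left_mono[OF decay_square_ge[OF 1], of "\<bar>h\<bar> * (s\<^sup>2 + 1)"] by simp
    also have "\<dots> = ?A" by (simp only: mult_ac)
    finally show ?thesis using nonneg by linarith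
  next
    case 2
    then have t: "t \<noteq> 0" by auto
    have "?l = \<bar>s\<bar> * \<bar>h\<bar> * (decay (h * t) * (\<bar>s\<bar> * decay (s * t)))"
      unfolding s2 by (simp only: mult_ac)
    also have "\<dots> \<le> \<bar>s\<bar> * \<bar>h\<bar> * (1 * (1 / \<bar>t\<bar>))"
      by (intro mult_left_mono mult_mono abs_times_decay_le[OF t] decay_le_1) (auto simp: decay_pos less_imp_le)
    also have "\<dots> = ?C" using 2 by simp
    finally show ?thesis using nonneg by linarith
  next
    case 3
    then have t: "t \<noteq> 0" by auto
    \<comment> \<open>In the tail |h t| \<ge> 1, so 1 / |t| can be converted back into |h| times
      \<open>decay (h * t)\<close>, producing a square that is integrable after rescaling.\<close>
    have "1 / \<bar>h * t\<bar> \<le> 2 * decay (h * t)"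
      using 3(2) assms(1) by (intro recip_le_decay) (simp add: field_simps abs_mult)
    then have "\<bar>h\<bar> * (1 / \<bar>h * t\<bar>) \<le> \<bar>h\<bar> * (2 * decay (h * t))" by (intro mult_left_mono) auto
    then have recip: "1 / \<bar>t\<bar> \<le> 2 * \<bar>h\<bar> * decay (h * t)" using assms(1) by (simp add: abs_mult)
    have "?l = \<bar>s\<bar> * \<bar>h\<bar> * decay (h * t) * (\<bar>s\<bar> * decay (s * t))"
      unfolding s2 by (simp only: mult_ac)
    also have "\<dots> \<le> \<bar>s\<bar> * \<bar>h\<bar> * decay (h * t) * (2 * \<bar>h\<bar> * decay (h * t))"
      by (intro mult_left_mono order_trans[OF abs_times_decay_le[OF t] recip]) (auto simp: decay_pos less_imp_le)
    also have "\<dots> = ?B / 2" by (simp add: power2_eq_square)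
    finally show ?thesis using nonneg by linarith
  qed
qed

lemma norm_ufun_scale_le: "norm (ufun s t) \<le> 4 * (\<bar>s\<bar> * decay (s * t))"
  using mult_left_mono[OF norm_ufun_le_decay[of "s * t"], of "\<bar>s\<bar>"]
  by (subst ufun_scale) (simp add: norm_mult)

lemma norm_du_scale_le: "norm (of_real (s\<^sup>2) * du (s * t)) \<le> 4 * (s\<^sup>2 * decay (s * t))"
  using mult_left_mono[OF norm_du_le_decay[of "s * t"], of "s\<^sup>2"] by (simp add: norm_mult norm_power)

lemma Omega_diff_log:
  "\<exists>k::real. \<forall>F\<in>Bc. \<forall>s h::real. 0 < \<bar>h\<bar> \<and> \<bar>h\<bar> < 1 / exp 1 \<longrightarrow>
        norm (Omega F (s + h) - Omega F s)
          \<le> k * alex F * (\<bar>s\<bar> * \<bar>h\<bar> * \<bar>ln \<bar>h\<bar>\<bar> + (s^2 + 1) * \<bar>h\<bar>)"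
proof -
  define Q where "Q = (LINT t|lborel. (decay t)\<^sup>2)"
  define c where "c = (LINT t|lborel. norm (dv t))"
  have Q: "Q \<ge> 0" by (simp add: Q_def)
  have c: "c \<ge> 0" by (simp add: c_def)
  \<comment> \<open>The factor 16 = 4 * 4 comes from the two kernel bounds. It gives 64 *
    \<open>Q\<close> three times: for the two decay terms of \<open>?A\<close>, where |s| \<le> s^2
    + 1 is used, and for \<open>?B\<close>. The summand 32 is 16 times the 2 of the logarithmic
    integral, and \<open>c\<close> pays for h^2 \<le> |h|.\<close>
  define k where "k = c + 192 * Q + 32"
  have "norm (Omega F (s + h) - Omega F s) \<le> k * alex F * (\<bar>s\<bar> * \<bar>h\<bar> * \<bar>ln \<bar>h\<bar>\<bar> + (s^2 + 1) * \<bar>h\<bar>)"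
    if F: "F \<in> Bc" and h: "0 < \<bar>h\<bar>" "\<bar>h\<bar> < 1 / exp 1" for F s h
  proof -
    have "1 / exp 1 \<le> (1::real)" by simp
    with h have h1: "\<bar>h\<bar> \<le> 1" by linarith
    let ?L = "\<lambda>t. indicator {t. 1 \<le> \<bar>t\<bar> \<and> \<bar>t\<bar> \<le> 1 / \<bar>h\<bar>} t / \<bar>t\<bar>"
    let ?A = "\<lambda>t. ufun h t * (of_real (s\<^sup>2) * du (s * t))" and ?B = "\<lambda>t. of_real (h\<^sup>2) * du (h * t) * ufun s t"
    define a b where "a = (\<lambda>t. 16 * (4 * (s\<^sup>2 + 1) * \<bar>h\<bar> * (decay t)\<^sup>2 + 4 * \<bar>s\<bar> * h\<^sup>2 * (decay (h * t))\<^sup>2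
      + \<bar>s\<bar> * \<bar>h\<bar> * ?L t))" and "b = (\<lambda>t. 16 * (4 * (s\<^sup>2 + 1) * \<bar>h\<bar> * (decay t)\<^sup>2))"
    have A: "norm (?A t) \<le> a t" for t
    proof -
      have "norm (?A t) \<le> (4 * (\<bar>h\<bar> * decay (h * t))) * (4 * (s\<^sup>2 * decay (s * t)))"
        unfolding norm_mult[of "ufun h t"]
        by (intro mult_mono norm_ufun_scale_le norm_du_scale_le) (auto simp: decay_pos less_imp_le)
      also have "\<dots> \<le> a t"
        using decay_product_le_log[OF h(1) h1, of t s] by (simp add: a_def)
      finally show ?thesis .
    qed
    have B: "norm (?B t) \<le> b t" for t
    proof -
      have "norm (?B t) \<le> (4 * (h\<^sup>2 * decay (h * t))) * (4 * (\<bar>s\<bar> * decay (s * t)))"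
        unfolding norm_mult[of _ "ufun s t"]
        by (intro mult_mono norm_ufun_scale_le norm_du_scale_le) (auto simp: decay_pos less_imp_le)
      also have "\<dots> \<le> b t"
        using decay_product_le[OF h1, of t s] by (simp add: b_def)
      finally show ?thesis .
    qed
    have H: "1 / \<bar>h\<bar> \<ge> 1" using h h1 by simp
    note L = abs_reciprocal_integral[OF H]
    have dec: "has_bochner_integral lborel (\<lambda>t. (decay t)\<^sup>2) Q"
      by (simp add: has_bochner_integral_iff decay_square_integrable Q_def)
    have dech: "has_bochner_integral lborel (\<lambda>t. (decay (h * t))\<^sup>2) (Q / \<bar>h\<bar>)"
      using lborel_integrable_real_affine[OF decay_square_integrable, of h 0]
        lborel_integral_real_affine[of h "\<lambda>t. (decay t)\<^sup>2" 0] h by (auto simp: has_bochner_integral_iff Q_def)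
    have "has_bochner_integral lborel ?L (2 * ln (1 / \<bar>h\<bar>))"
      using abs_reciprocal_integral[OF H] by (simp only: has_bochner_integral_iff simp_thms)
    also have "ln (1 / \<bar>h\<bar>) = \<bar>ln \<bar>h\<bar>\<bar>" using h h1 by (simp add: ln_div)
    finally have L: "has_bochner_integral lborel ?L (2 * \<bar>ln \<bar>h\<bar>\<bar>)" .
    have a: "has_bochner_integral lborel a (16 * (4 * (s\<^sup>2 + 1) * \<bar>h\<bar> * Q
        + 4 * \<bar>s\<bar> * h\<^sup>2 * (Q / \<bar>h\<bar>) + \<bar>s\<bar> * \<bar>h\<bar> * (2 * \<bar>ln \<bar>h\<bar>\<bar>)))"
      unfolding a_def by (intro has_bochner_integral_mult_right has_bochner_integral_add dec dech L)
    have b: "has_bochner_integral lborel b (16 * (4 * (s\<^sup>2 + 1) * \<bar>h\<bar> * Q))"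
      unfolding b_def by (intro has_bochner_integral_mult_right dec)
    note ia = a[unfolded has_bochner_integral_iff, THEN conjunct1]
      and ib = b[unfolded has_bochner_integral_iff, THEN conjunct1]
    define X Y where "X = \<bar>s\<bar> * \<bar>h\<bar> * \<bar>ln \<bar>h\<bar>\<bar>" and "Y = (s\<^sup>2 + 1) * \<bar>h\<bar>"
    have XY: "X \<ge> 0" "Y \<ge> 0" by (auto simp: X_def Y_def)
    have [measurable]: "ufun s \<in> borel_measurable borel" "ufun h \<in> borel_measurable borel"
      unfolding ufun_scale[of s, abs_def] ufun_scale[of h, abs_def] by measurable
    have iA: "integrable lborel ?A"
    proof (rule Bochner_Integration.integrable_bound[OF ia])
      show "AE t in lborel. norm (?A t) \<le> norm (a t)"
        unfolding real_norm_def by (intro AE_I2 order_trans[OF A abs_ge_self])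
    qed measurable
    have iB: "integrable lborel ?B"
    proof (rule Bochner_Integration.integrable_bound[OF ib])
      show "AE t in lborel. norm (?B t) \<le> norm (b t)"
        unfolding real_norm_def by (intro AE_I2 order_trans[OF B abs_ge_self])
    qed measurable
    have "(LINT t|lborel. norm (?A t)) \<le> integral\<^sup>L lborel a"
      by (intro integral_mono integrable_norm iA A ia)
    also have "\<dots> = 64 * Y * Q + 64 * (\<bar>s\<bar> * \<bar>h\<bar> * Q) + 32 * X"
    proof -
      have "h\<^sup>2 * (Q / \<bar>h\<bar>) = \<bar>h\<bar> * Q"
        using h by (simp add: power2_eq_square nonzero_divide_eq_eq)
      then show ?thesis
        unfolding has_bochner_integral_integral_eq[OF a] mult.assoc[of _ "h\<^sup>2"]
        by (simp add: X_def Y_def algebra_simps)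
    qed
    also have "\<bar>s\<bar> * \<bar>h\<bar> * Q \<le> Y * Q"
      unfolding Y_def using sum_squares_bound[of "\<bar>s\<bar>" 1] Q by (intro mult_right_mono) auto
    finally have IA: "(LINT t|lborel. norm (?A t)) \<le> 128 * (Y * Q) + 32 * X" by linarith
    have "(LINT t|lborel. norm (?B t)) \<le> integral\<^sup>L lborel b"
      by (intro integral_mono integrable_norm iB B ib)
    also have "\<dots> = 64 * (Y * Q)"
      using has_bochner_integral_integral_eq[OF b] by (simp add: Y_def)
    finally have IB: "(LINT t|lborel. norm (?B t)) \<le> 64 * (Y * Q)" .
    have "h\<^sup>2 \<le> 1 * \<bar>h\<bar>" using mult_right_mono[OF h1, of "\<bar>h\<bar>"] by (simp add: power2_eq_square)
    also have "\<dots> \<le> Y" unfolding Y_def by (intro mult_right_mono) auto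
    finally have "c * h\<^sup>2 \<le> c * Y" using c by (intro mult_left_mono)
    with IA IB have "c * h\<^sup>2 + (LINT t|lborel. norm (?A t)) + (LINT t|lborel. norm (?B t)) \<le> c * Y + 192 * (Y * Q) + 32 * X"
      by linarith
    also have "\<dots> \<le> k * (X + Y)"
      using XY c Q by (simp add: k_def algebra_simps)
    finally have "alex F * (c * h\<^sup>2 + (LINT t|lborel. norm (?A t)) + (LINT t|lborel. norm (?B t))) \<le> alex F * (k * (X + Y))"
      by (intro mult_left_mono alex_nonneg F)
    with norm_Omega_diff_le[OF F iA iB] show ?thesis
      unfolding c_def[symmetric] X_def[symmetric] Y_def[symmetric] by (simp only: mult_ac)
  qed
  then show ?thesis by blast
qed

theorem mainTheorem1:
  defines "c \<equiv> LINT t|lborel. norm (vector_derivative (vfun 1) (at t))"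
  shows
  \<comment> \<open>(a)\<close>
  "c = tvar (vfun 1)
   \<and> (\<forall>F\<in>Bc. \<forall>s::real. norm (Omega F s) \<le> c * alex F * s^2)
   \<and> (\<forall>F\<in>Bc. (Omega F has_vector_derivative 0) (at 0))
   \<and> (\<forall>c' < c. \<exists>F\<in>Bc. \<exists>s::real. norm (Omega F s) > c' * alex F * s^2)
  \<comment> \<open>(b)\<close>
   \<and> (\<forall>F\<in>Bc. ((\<lambda>s. Omega F s / complex_of_real (s^2)) \<longlongrightarrow> Finf F / 2) (at 0))
   \<and> (\<forall>F\<in>Bc. ((\<lambda>s. Omega F s / complex_of_real (s^2)) \<longlongrightarrow> 0) at_infinity)
   \<and> (\<forall>\<psi> :: real \<Rightarrow> real. (\<forall>s\<ge>0. \<psi> s > 0) \<and> ((\<lambda>s. \<psi> s / s^2) \<longlongrightarrow> 0) at_top \<longrightarrow>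
        (\<exists>f :: real \<Rightarrow> complex. \<exists>F\<in>Bc. f integrable_on UNIV
            \<and> (\<forall>x. (f has_integral F x) {..x})
            \<and> \<not> ((\<lambda>s. Omega F s / complex_of_real (\<psi> s)) \<longlongrightarrow> 0) at_top))
  \<comment> \<open>(c)\<close>
   \<and> (\<exists>k::real. \<forall>F\<in>Bc. \<forall>s h::real. 0 < \<bar>h\<bar> \<and> \<bar>h\<bar> < 1 / exp 1 \<longrightarrow>
        norm (Omega F (s + h) - Omega F s)
          \<le> k * alex F * (\<bar>s\<bar> * \<bar>h\<bar> * \<bar>ln \<bar>h\<bar>\<bar> + (s^2 + 1) * \<bar>h\<bar>))
   \<and> (\<forall>F\<in>Bc. continuous_on UNIV (Omega F))
   \<and> (\<forall>F\<in>Bc. \<forall>a b \<alpha>::real. 0 < \<alpha> \<and> \<alpha> < 1 \<longrightarrow>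
        (\<exists>M. \<forall>x\<in>{a..b}. \<forall>y\<in>{a..b}. norm (Omega F x - Omega F y) \<le> M * \<bar>x - y\<bar> powr \<alpha>))
  \<comment> \<open>(d)\<close>
   \<and> (\<exists>F\<in>Bc. \<not> (\<exists>L. L-lipschitz_on UNIV (Omega F)))
  \<comment> \<open>(e)\<close>
   \<and> (\<forall>\<rho> \<sigma>::real. 1 < \<rho> \<and> 1 / \<rho> + 1 / \<sigma> = 1 \<longrightarrow>
        (\<forall>F\<in>Bc. \<forall>s h::real.
          norm (Omega F (s + h) - Omega F s)
            \<le> alex F * (tvar (vfun 1) * h^2
               + Lpnorm \<rho> (\<lambda>t. vector_derivative (ufun 1) (at t)) * Lpnorm \<sigma> (ufun 1)
                   * \<bar>h\<bar> powr (2 - 1 / \<rho>) * \<bar>s\<bar> powr (1 / \<rho>)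
               + Lpnorm \<rho> (ufun 1) * Lpnorm \<sigma> (\<lambda>t. vector_derivative (ufun 1) (at t))
                   * \<bar>h\<bar> powr (1 - 1 / \<rho>) * \<bar>s\<bar> powr (1 + 1 / \<rho>))))"
  unfolding c_def
  using tvar_vfun norm_Omega_le Omega_has_vector_derivative_0 Omega_best_constant
    Omega_asymp_0 Omega_asymp_infinity growth_sharp Omega_diff_log continuous_Omega
    Omega_Holder_continuous Omega_not_Lipschitz Omega_diff_Holder
  by (intro conjI) (simp | blast)+

end
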